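(* Let $A_1,A_2,A_3$ be finitely generated groups and let $C\leq A_1\times A_2\times A_3$ be a subdirect product such that the projection of $C$ onto any two components is a subdirect product over a virtually nilpotent quotient. Then $C$ is finitely generated.
   Context: A subgroup $C\leq A_1\times A_2\times A_3$ is a subdirect product if each coordinate projection $\pi_i$ maps $C$ onto $A_i$. For $i\neq j$, the projection $\pi_{ij}(C)$ of $C$ onto the components $i,j$ is then a subdirect product of $A_i$ and $A_j$ (i.e. a subgroup of $A_i\times A_j$ projecting onto both factors). The quotient of a subdirect product $S\leq A\times B$ of groups is the group $S/(\ker\pi_A\cdot\ker\pi_B)$, where $\pi_A\colon S\to A$, $\pi_B\colon S\to B$ are the projections; for $S=\pi_{ij}(C)$ it is isomorphic to $C/N_iN_j$ where $N_i$ is the kernel of $\pi_i$ restricted to $C$. "Subdirect product over a virtually nilpotent quotient" means that this quotient group is virtually nilpotent, i.e. has a nilpotent subgroup of finite index. *)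

theory Defs
  imports "HOL-Algebra.Algebra"
begin

definition finitely_generated_group :: "('a, 'm) monoid_scheme \<Rightarrow> bool" where
  "finitely_generated_group G \<longleftrightarrow>
     group G \<and> (\<exists>S. finite S \<and> S \<subseteq> carrier G \<and> generate G S = carrier G)"

(* The indexing starts at the whole group: term n is what is usually called gamma_(n+1)(G). *)
primrec lower_central_series :: "('a, 'm) monoid_scheme \<Rightarrow> nat \<Rightarrow> 'a set" where
  "lower_central_series G 0 = carrier G"
| "lower_central_series G (Suc n) =
     generate G (\<Union>x \<in> lower_central_series G n. \<Union>g \<in> carrier G.
       {x \<otimes>\<^bsub>G\<^esub> g \<otimes>\<^bsub>G\<^esub> inv\<^bsub>G\<^esub> x \<otimes>\<^bsub>G\<^esub> inv\<^bsub>G\<^esub> g})"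

definition nilpotent_group :: "('a, 'm) monoid_scheme \<Rightarrow> bool" where
  "nilpotent_group G \<longleftrightarrow> group G \<and> (\<exists>n. lower_central_series G n = {\<one>\<^bsub>G\<^esub>})"

definition virtually_nilpotent_group :: "('a, 'm) monoid_scheme \<Rightarrow> bool" where
  "virtually_nilpotent_group G \<longleftrightarrow>
     group G \<and>
     (\<exists>H. subgroup H G \<and> finite (rcosets\<^bsub>G\<^esub> H) \<and> nilpotent_group (G\<lparr>carrier := H\<rparr>))"

definition subdirect2 ::
    "('a, 'm) monoid_scheme \<Rightarrow> ('b, 'n) monoid_scheme \<Rightarrow> ('a \<times> 'b) set \<Rightarrow> bool" where
  "subdirect2 A B S \<longleftrightarrow>
     subgroup S (A \<times>\<times> B) \<and> fst ` S = carrier A \<and> snd ` S = carrier B"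

definition subdirect2_quotient ::
    "('a, 'm) monoid_scheme \<Rightarrow> ('b, 'n) monoid_scheme \<Rightarrow> ('a \<times> 'b) set \<Rightarrow> ('a \<times> 'b) set monoid" where
  "subdirect2_quotient A B S =
     (let G = (A \<times>\<times> B)\<lparr>carrier := S\<rparr> in G Mod (kernel G A fst <#>\<^bsub>G\<^esub> kernel G B snd))"

definition subdirect2_over_virtually_nilpotent ::
    "('a, 'm) monoid_scheme \<Rightarrow> ('b, 'n) monoid_scheme \<Rightarrow> ('a \<times> 'b) set \<Rightarrow> bool" where
  "subdirect2_over_virtually_nilpotent A B S \<longleftrightarrow>
     subdirect2 A B S \<and> virtually_nilpotent_group (subdirect2_quotient A B S)"

definition subdirect3 ::
    "('a, 'm) monoid_scheme \<Rightarrow> ('b, 'n) monoid_scheme \<Rightarrow> ('c, 'k) monoid_scheme \<Rightarrow>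
     ('a \<times> 'b \<times> 'c) set \<Rightarrow> bool" where
  "subdirect3 A1 A2 A3 C \<longleftrightarrow>
     subgroup C (A1 \<times>\<times> A2 \<times>\<times> A3) \<and>
     (\<lambda>(x, y, z). x) ` C = carrier A1 \<and>
     (\<lambda>(x, y, z). y) ` C = carrier A2 \<and>
     (\<lambda>(x, y, z). z) ` C = carrier A3"

(* The subgroup divided out in subdirect2_quotient is normal, so Mod is the genuine quotient. *)
lemma subdirect2_kernels_normal:
  fixes A :: "('a, 'm) monoid_scheme" and B :: "('b, 'n) monoid_scheme"
  assumes "group A" "group B" "subdirect2 A B S"
  defines "G \<equiv> (A \<times>\<times> B)\<lparr>carrier := S\<rparr>"
  shows "(kernel G A fst <#>\<^bsub>G\<^esub> kernel G B snd) \<lhd> G"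
proof -
  have S: "subgroup S (A \<times>\<times> B)" and im: "fst ` S = carrier A" "snd ` S = carrier B"
    using assms(3) by (auto simp: subdirect2_def)
  have G: "group G"
    unfolding G_def using S DirProd_group[OF assms(1,2)] by (simp add: subgroup.subgroup_is_group)
  have "group_hom G A fst"
    using G assms(1) im by (auto simp: group_hom_def group_hom_axioms_def hom_def G_def mult_DirProd')
  moreover have "group_hom G B snd"
    using G assms(2) im by (auto simp: group_hom_def group_hom_axioms_def hom_def G_def mult_DirProd')
  ultimately have "kernel G A fst \<lhd> G" "kernel G B snd \<lhd> G"
    by (simp_all add: group_hom.normal_kernel)
  then show ?thesis
    by (rule group.normal_subgroup_set_mult_closed[OF G])
qed

end

theory Submission
  imports Defs
begin

text \<open>
  Write \<open>N1\<close>, \<open>N2\<close>, \<open>N3\<close> for the kernels of the three projections of \<open>C\<close>. A fibre product of two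
  finitely generated groups over a finitely presented group is finitely generated, and finitely
  generated virtually nilpotent groups are finitely presented
  (\<open>normal_closure_finite_if_virtually_nilpotent_quotient\<close>). Hence all three projections of \<open>C\<close> to
  pairs of factors are finitely generated (\<open>pair_finitely_generated\<close>). The group \<open>C\<close> is in turn a
  fibre product of its projection to \<open>A1 \<times> A2\<close> with \<open>A3\<close>, but now over \<open>C/(N1 \<inter> N2)N3\<close>, which can
  fail to be finitely presented, so this argument cannot be repeated.

  Instead, let \<open>J\<close> be a finitely generated subgroup of \<open>C\<close> that surjects onto the projection to each
  pair. It remains to enlarge \<open>J\<close> by finitely many elements so that it contains \<open>R = N1 \<inter> N2\<close>, a
  subgroup of the factor \<open>A3\<close>. Surjectivity onto the pairs \<open>(1,3)\<close> and \<open>(2,3)\<close> implies that \<open>J\<close> contains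
  all commutators of \<open>N1\<close> with \<open>N2\<close>. Let \<open>B1\<close>, \<open>B2\<close> be the images of \<open>N1\<close>, \<open>N2\<close> in \<open>A3\<close>. So only
  \<open>R/[B1, B2]\<close> matters, as a module for \<open>A3\<close> acting by conjugation. It is a submodule of
  \<open>(B1 \<inter> B2)/[B1, B2]\<close>, which is abelian. That module is finitely generated, since \<open>A3/(B1 \<inter> B2)\<close>
  is finitely generated and virtually nilpotent and thus finitely presented; and \<open>B1\<close> acts
  trivially on it, so the acting group is the virtually nilpotent group \<open>A3/B1\<close>. By P. Hall's
  extension of Hilbert's basis theorem to group rings of polycyclic groups
  (\<open>noetherian_under_polycyclic\<close>) the module is Noetherian, and \<open>R/[B1, B2]\<close> is finitely generated
  (\<open>normal_closure_finite_with_commutators\<close>).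

  Modules over group rings appear throughout as abelian normal subgroups with the conjugation
  action, and quotients mostly as statements relative to a subgroup.
\<close>

section \<open>Invariant subgroups and normal generation\<close>

abbreviation commutator :: "('a, 'm) monoid_scheme \<Rightarrow> 'a \<Rightarrow> 'a \<Rightarrow> 'a" where
  "commutator G x y \<equiv> x \<otimes>\<^bsub>G\<^esub> y \<otimes>\<^bsub>G\<^esub> inv\<^bsub>G\<^esub> x \<otimes>\<^bsub>G\<^esub> inv\<^bsub>G\<^esub> y"

definition invariant_under :: "('a, 'm) monoid_scheme \<Rightarrow> 'a set \<Rightarrow> 'a set \<Rightarrow> bool" where
  "invariant_under G H R \<longleftrightarrow> (\<forall>h\<in>H. \<forall>r\<in>R. h \<otimes>\<^bsub>G\<^esub> r \<otimes>\<^bsub>G\<^esub> inv\<^bsub>G\<^esub> h \<in> R)"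

text \<open>The normal closure of \<open>Y\<close> when \<open>H\<close> is the whole group. For an abelian normal subgroup on
which \<open>H\<close> acts by conjugation it is the \<open>\<int>H\<close>-submodule generated by \<open>Y\<close>.\<close>

definition conj_closure :: "('a, 'm) monoid_scheme \<Rightarrow> 'a set \<Rightarrow> 'a set \<Rightarrow> 'a set" where
  "conj_closure G H Y = generate G {h \<otimes>\<^bsub>G\<^esub> y \<otimes>\<^bsub>G\<^esub> inv\<^bsub>G\<^esub> h |h y. h \<in> H \<and> y \<in> Y}"

lemma invariant_underD:
  "invariant_under G H R \<Longrightarrow> h \<in> H \<Longrightarrow> r \<in> R \<Longrightarrow> h \<otimes>\<^bsub>G\<^esub> r \<otimes>\<^bsub>G\<^esub> inv\<^bsub>G\<^esub> h \<in> R"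
  by (simp add: invariant_under_def)

lemma invariant_under_mono: "invariant_under G H R \<Longrightarrow> K \<subseteq> H \<Longrightarrow> invariant_under G K R"
  by (auto simp: invariant_under_def)

context group
begin

text \<open>Together with associativity and the inverse of a product these cancellation rules bring every
group word to reduced form; this is how all the commutator and conjugation identities below
are checked.\<close>

lemma inv_mult_cancel [simp]: "x \<in> carrier G \<Longrightarrow> y \<in> carrier G \<Longrightarrow> inv x \<otimes> (x \<otimes> y) = y"
  by (simp flip: m_assoc)

lemma mult_inv_cancel [simp]: "x \<in> carrier G \<Longrightarrow> y \<in> carrier G \<Longrightarrow> x \<otimes> (inv x \<otimes> y) = y"
  by (simp flip: m_assoc)

lemmas word = m_assoc inv_mult_group

text \<open>Conjugation is a homomorphism, so it suffices to test its effect on generators.\<close>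

lemma conj_preimage_subgroup:
  assumes "subgroup R G" "k \<in> carrier G"
  shows "subgroup {x \<in> carrier G. k \<otimes> x \<otimes> inv k \<in> R} G"
proof (rule subgroupI)
  show "{x \<in> carrier G. k \<otimes> x \<otimes> inv k \<in> R} \<noteq> {}"
    using assms subgroup.one_closed[of R G] by (auto intro!: exI[of _ \<one>])
next
  fix x assume "x \<in> {x \<in> carrier G. k \<otimes> x \<otimes> inv k \<in> R}"
  then have x: "x \<in> carrier G" "inv (k \<otimes> x \<otimes> inv k) \<in> R"
    using assms by (auto intro: subgroup.m_inv_closed)
  with assms show "inv x \<in> {x \<in> carrier G. k \<otimes> x \<otimes> inv k \<in> R}"
    by (simp add: word)
next
  fix x y assume "x \<in> {x \<in> carrier G. k \<otimes> x \<otimes> inv k \<in> R}"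
    "y \<in> {x \<in> carrier G. k \<otimes> x \<otimes> inv k \<in> R}"
  then have x: "x \<in> carrier G" "y \<in> carrier G" "(k \<otimes> x \<otimes> inv k) \<otimes> (k \<otimes> y \<otimes> inv k) \<in> R"
    using assms by (auto intro: subgroup.m_closed)
  with assms show "x \<otimes> y \<in> {x \<in> carrier G. k \<otimes> x \<otimes> inv k \<in> R}"
    by (simp add: word)
qed auto

lemma generate_conj:
  assumes "subgroup R G" "k \<in> carrier G" "U \<subseteq> carrier G"
    and "\<And>x. x \<in> U \<Longrightarrow> k \<otimes> x \<otimes> inv k \<in> R" and "x \<in> generate G U"
  shows "k \<otimes> x \<otimes> inv k \<in> R"
  using generate_subgroup_incl[OF _ conj_preimage_subgroup[OF assms(1,2)], of U] assms by auto

lemma invariant_under_generate: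
  assumes R: "R \<subseteq> carrier G" and K: "K \<subseteq> carrier G"
    and inv: "\<And>k r. k \<in> K \<Longrightarrow> r \<in> R \<Longrightarrow> k \<otimes> r \<otimes> inv k \<in> R \<and> inv k \<otimes> r \<otimes> k \<in> R"
  shows "invariant_under G (generate G K) R"
  unfolding invariant_under_def
proof
  fix k assume "k \<in> generate G K"
  then show "\<forall>r\<in>R. k \<otimes> r \<otimes> inv k \<in> R"
  proof induction
    case (eng h1 h2)
    have c: "h1 \<in> carrier G" "h2 \<in> carrier G"
      using eng generate_in_carrier[OF K] by auto
    show ?case
    proof
      fix r assume r: "r \<in> R"
      then have "h1 \<otimes> (h2 \<otimes> r \<otimes> inv h2) \<otimes> inv h1 \<in> R"
        using eng by blast
      then show "h1 \<otimes> h2 \<otimes> r \<otimes> inv (h1 \<otimes> h2) \<in> R"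
        using c r R by (simp add: word subset_iff)
    qed
  qed (use R K inv in \<open>auto simp: subset_iff\<close>)
qed

lemma conj_closure_subgroup:
  assumes "H \<subseteq> carrier G" "Y \<subseteq> carrier G"
  shows "subgroup (conj_closure G H Y) G"
  unfolding conj_closure_def using assms by (intro generate_is_subgroup) auto

lemma conj_closure_contains:
  assumes "subgroup H G" "Y \<subseteq> carrier G"
  shows "Y \<subseteq> conj_closure G H Y"
proof
  fix y assume y: "y \<in> Y"
  have "\<one> \<otimes> y \<otimes> inv \<one> = y" using y assms by auto
  then show "y \<in> conj_closure G H Y"
    unfolding conj_closure_def using y subgroup.one_closed[OF assms(1)]
    by (intro generate.incl) force
qed

lemma conj_closure_least:
  assumes "subgroup R G" "invariant_under G H R" "Y \<subseteq> R"
  shows "conj_closure G H Y \<subseteq> R"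
  unfolding conj_closure_def
  using assms by (intro generate_subgroup_incl) (auto simp: invariant_under_def)

lemma conj_closure_invariant:
  assumes H: "subgroup H G" and Y: "Y \<subseteq> carrier G"
  shows "invariant_under G H (conj_closure G H Y)"
  unfolding invariant_under_def
proof (intro ballI)
  note Hc = subgroup.subset[OF H]
  fix h r assume h: "h \<in> H" and r: "r \<in> conj_closure G H Y"
  let ?U = "{h \<otimes> y \<otimes> inv h |h y. h \<in> H \<and> y \<in> Y}"
  show "h \<otimes> r \<otimes> inv h \<in> conj_closure G H Y"
  proof (rule generate_conj)
    show "subgroup (conj_closure G H Y) G" using conj_closure_subgroup Hc Y .
    show "r \<in> generate G ?U" using r by (simp add: conj_closure_def)
    show "?U \<subseteq> carrier G" using Hc Y by auto
    show "h \<in> carrier G" using h Hc by auto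
    fix x assume "x \<in> ?U"
    then obtain k y where k: "k \<in> H" "y \<in> Y" and x: "x = k \<otimes> y \<otimes> inv k" by auto
    have "h \<otimes> x \<otimes> inv h = (h \<otimes> k) \<otimes> y \<otimes> inv (h \<otimes> k)"
      using h k Hc Y by (simp add: x word subset_iff)
    moreover have "h \<otimes> k \<in> H" using h k H by (simp add: subgroup.m_closed)
    ultimately show "h \<otimes> x \<otimes> inv h \<in> conj_closure G H Y"
      unfolding conj_closure_def using k by (intro generate.incl) blast
  qed
qed

lemma normal_iff_invariant:
  "N \<lhd> G \<longleftrightarrow> subgroup N G \<and> invariant_under G (carrier G) N"
  by (simp add: normal_inv_iff invariant_under_def)

lemma conj_closure_normal: "Y \<subseteq> carrier G \<Longrightarrow> conj_closure G (carrier G) Y \<lhd> G"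
  using conj_closure_subgroup conj_closure_invariant subgroup_self
  by (simp add: normal_iff_invariant)

section \<open>The lower central series of a subgroup\<close>

text \<open>The lower central series of a subgroup \<open>H\<close> lives in the group \<open>H\<close> itself; its recursion is
restated with the operations of the ambient group, so that different subgroups can be compared.\<close>

lemma lower_central_series_relative:
  assumes H: "subgroup H G"
  shows "lower_central_series (G\<lparr>carrier := H\<rparr>) n \<subseteq> H \<and>
    lower_central_series (G\<lparr>carrier := H\<rparr>) (Suc n) =
      generate G {commutator G x h |x h. x \<in> lower_central_series (G\<lparr>carrier := H\<rparr>) n \<and> h \<in> H}"
proof (induction n)
  have inH: "commutator G x h \<in> H" if "x \<in> H" "h \<in> H" for x h
    using that H by (simp add: subgroup.m_closed subgroup.m_inv_closed)
  have step: "lower_central_series (G\<lparr>carrier := H\<rparr>) (Suc n) =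
      generate G {commutator G x h |x h. x \<in> lower_central_series (G\<lparr>carrier := H\<rparr>) n \<and> h \<in> H}"
    if sub: "lower_central_series (G\<lparr>carrier := H\<rparr>) n \<subseteq> H" for n
  proof -
    have "(\<Union>x \<in> lower_central_series (G\<lparr>carrier := H\<rparr>) n. \<Union>g \<in> H.
       {x \<otimes> g \<otimes> inv\<^bsub>G\<lparr>carrier := H\<rparr>\<^esub> x \<otimes> inv\<^bsub>G\<lparr>carrier := H\<rparr>\<^esub> g}) =
       {commutator G x h |x h. x \<in> lower_central_series (G\<lparr>carrier := H\<rparr>) n \<and> h \<in> H}"
      (is "?A = ?B")
    proof -
      have "?A = (\<Union>x \<in> lower_central_series (G\<lparr>carrier := H\<rparr>) n. \<Union>g \<in> H. {commutator G x g})"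
        using sub by (intro SUP_cong) (auto simp: m_inv_consistent[OF H] subset_iff)
      then show ?thesis by auto
    qed
    moreover have "?B \<subseteq> H"
      using sub inH by auto
    ultimately show ?thesis
      using sub H by (simp add: generate_consistent)
  qed
  case 0
  show ?case using step[of 0] by simp
  case (Suc n)
  have "generate G {commutator G x h |x h. x \<in> lower_central_series (G\<lparr>carrier := H\<rparr>) n \<and> h \<in> H} \<subseteq> H"
    using Suc inH by (intro generate_subgroup_incl[OF _ H]) auto
  then have "lower_central_series (G\<lparr>carrier := H\<rparr>) (Suc n) \<subseteq> H"
    using Suc by simp
  then show ?case using step by blast
qed

lemmas lower_central_series_subset = lower_central_series_relative[THEN conjunct1]
lemmas lower_central_series_Suc = lower_central_series_relative[THEN conjunct2]

context
  fixes H \<gamma>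
  assumes H: "subgroup H G"
  defines "\<gamma> \<equiv> lower_central_series (G\<lparr>carrier := H\<rparr>)"
begin

lemma lcs_0: "\<gamma> 0 = H" by (simp add: \<gamma>_def)

lemma lcs_Suc: "\<gamma> (Suc n) = generate G {commutator G x h |x h. x \<in> \<gamma> n \<and> h \<in> H}"
  unfolding \<gamma>_def by (rule lower_central_series_Suc[OF H])

lemma lcs_subset: "\<gamma> n \<subseteq> H"
  unfolding \<gamma>_def by (rule lower_central_series_subset[OF H])

lemma lcs_carrier: "\<gamma> n \<subseteq> carrier G" and H_carrier: "H \<subseteq> carrier G"
  using lcs_subset subgroup.subset[OF H] by auto

lemma lcs_subgroup: "subgroup (\<gamma> n) G"
proof (cases n)
  case 0 then show ?thesis using H by (simp add: \<gamma>_def)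
next
  case (Suc m)
  show ?thesis unfolding Suc lcs_Suc
    using lcs_carrier H_carrier by (intro generate_is_subgroup) (auto simp: subset_iff)
qed

lemma lcs_commutator: "x \<in> \<gamma> n \<Longrightarrow> h \<in> H \<Longrightarrow> commutator G x h \<in> \<gamma> (Suc n)"
  unfolding lcs_Suc by (intro generate.incl) blast

lemma lcs_invariant: "invariant_under G H (\<gamma> n)"
proof (induction n)
  case 0 then show ?case
    using H by (auto simp: lcs_0 invariant_under_def subgroup.m_closed subgroup.m_inv_closed)
next
  case (Suc n)
  note c = subsetD[OF lcs_carrier] subsetD[OF H_carrier]
  show ?case unfolding invariant_under_def
  proof (intro ballI)
    fix h r assume h: "h \<in> H" and r: "r \<in> \<gamma> (Suc n)"
    show "h \<otimes> r \<otimes> inv h \<in> \<gamma> (Suc n)"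
    proof (rule generate_conj[OF lcs_subgroup])
      show "r \<in> generate G {commutator G x h |x h. x \<in> \<gamma> n \<and> h \<in> H}"
        using r by (simp add: lcs_Suc)
      show "h \<in> carrier G" using h H_carrier by auto
      show "{commutator G x h |x h. x \<in> \<gamma> n \<and> h \<in> H} \<subseteq> carrier G"
        using c by auto
      fix z assume "z \<in> {commutator G x h |x h. x \<in> \<gamma> n \<and> h \<in> H}"
      then obtain x g where x: "x \<in> \<gamma> n" "g \<in> H" and z: "z = commutator G x g" by auto
      have "h \<otimes> z \<otimes> inv h = commutator G (h \<otimes> x \<otimes> inv h) (h \<otimes> g \<otimes> inv h)"
        using c(1)[OF x(1)] c(2)[OF x(2)] c(2)[OF h] by (simp add: z word)
      moreover have "h \<otimes> x \<otimes> inv h \<in> \<gamma> n" using Suc x h by (simp add: invariant_under_def)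
      moreover have "h \<otimes> g \<otimes> inv h \<in> H"
        using H x h by (simp add: subgroup.m_closed subgroup.m_inv_closed)
      ultimately show "h \<otimes> z \<otimes> inv h \<in> \<gamma> (Suc n)" using lcs_commutator by simp
    qed
  qed
qed

lemma lcs_Suc_subset: "\<gamma> (Suc n) \<subseteq> \<gamma> n"
proof -
  have "commutator G x h \<in> \<gamma> n" if "x \<in> \<gamma> n" "h \<in> H" for x h
  proof -
    have "h \<otimes> inv x \<otimes> inv h \<in> \<gamma> n"
      using that lcs_invariant subgroup.m_inv_closed[OF lcs_subgroup] by (simp add: invariant_under_def)
    then have "x \<otimes> (h \<otimes> inv x \<otimes> inv h) \<in> \<gamma> n"
      using that subgroup.m_closed[OF lcs_subgroup] by blast
    then show ?thesis
      using subsetD[OF lcs_carrier that(1)] subsetD[OF H_carrier that(2)] by (simp add: word)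
  qed
  then show ?thesis unfolding lcs_Suc[of n]
    by (intro generate_subgroup_incl[OF _ lcs_subgroup]) auto
qed

lemma lcs_antimono: "m \<le> n \<Longrightarrow> \<gamma> n \<subseteq> \<gamma> m"
  using lcs_Suc_subset by (rule lift_Suc_antimono_le)

text \<open>If \<open>H\<close> is generated by \<open>S\<close>, each term is the normal closure of the iterated left-normed
commutators in \<open>S\<close>. In the inductive step let \<open>N\<close> be the normal closure of the commutators
\<open>[y, s]\<close>. The elements commuting with \<open>y\<close> modulo \<open>N\<close> form a subgroup containing \<open>S\<close>, so each
\<open>y\<close> is central modulo \<open>N\<close>. The elements that are central modulo \<open>N\<close> form a normal subgroup, so it
contains the normal closure of the \<open>y\<close>, which is the previous term.\<close>

lemma lcs_finitely_normally_generated: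
  assumes S: "H = generate G S" "finite S" "S \<subseteq> carrier G"
  shows "\<exists>Y. finite Y \<and> Y \<subseteq> \<gamma> n \<and> \<gamma> n = conj_closure G H Y"
proof (induction n)
  case 0
  have SH: "S \<subseteq> H" using S(1) by (auto intro: generate.incl)
  have "H \<subseteq> conj_closure G H S"
    using generate_subgroup_incl[OF conj_closure_contains[OF H S(3)] conj_closure_subgroup[OF H_carrier S(3)]]
    by (simp flip: S(1))
  moreover have "conj_closure G H S \<subseteq> H"
    using lcs_invariant[of 0] by (intro conj_closure_least[OF H _ SH]) (simp add: lcs_0)
  ultimately show ?case using S(2) SH by (auto simp: lcs_0)
next
  case (Suc n)
  then obtain Y where Y: "finite Y" "Y \<subseteq> \<gamma> n" "\<gamma> n = conj_closure G H Y" by auto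
  have SH: "S \<subseteq> H" using S(1) by (auto intro: generate.incl)
  define Z where "Z = (\<lambda>(y, s). commutator G y s) ` (Y \<times> S)"
  have Zsub: "Z \<subseteq> \<gamma> (Suc n)" using subsetD[OF Y(2)] SH lcs_commutator[of _ n] by (auto simp: Z_def)
  define N where "N = conj_closure G H Z"
  have Zc: "Z \<subseteq> carrier G" using Zsub lcs_carrier by blast
  have N: "subgroup N G" unfolding N_def using conj_closure_subgroup[OF H_carrier Zc] .
  have Ninv: "invariant_under G H N" unfolding N_def using conj_closure_invariant[OF H Zc] .
  have Nc: "N \<subseteq> carrier G" using N by (rule subgroup.subset)
  note c = subsetD[OF lcs_carrier] subsetD[OF H_carrier] subsetD[OF Nc]
  note Ncl = subgroup.m_closed[OF N] subgroup.m_inv_closed[OF N]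
  \<comment> \<open>the elements that commute with \<open>y\<close> modulo \<open>N\<close>\<close>
  have sub2: "subgroup {h \<in> H. commutator G y h \<in> N} G" if y: "y \<in> H" for y
  proof (rule subgroupI)
    show "{h \<in> H. commutator G y h \<in> N} \<subseteq> carrier G" using c by auto
    show "{h \<in> H. commutator G y h \<in> N} \<noteq> {}"
      using subgroup.one_closed[OF H] subgroup.one_closed[OF N] c(2)[OF y]
      by (auto intro!: exI[of _ \<one>])
  next
    fix a assume a: "a \<in> {h \<in> H. commutator G y h \<in> N}"
    then have "inv a \<otimes> inv (commutator G y a) \<otimes> inv (inv a) \<in> N"
      using invariant_underD[OF Ninv] Ncl subgroup.m_inv_closed[OF H] by blast
    moreover have "a \<in> carrier G" "inv a \<in> H" using a c subgroup.m_inv_closed[OF H] by auto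
    ultimately show "inv a \<in> {h \<in> H. commutator G y h \<in> N}"
      using c(2)[OF y] by (simp add: word)
  next
    fix a b assume a: "a \<in> {h \<in> H. commutator G y h \<in> N}" and b: "b \<in> {h \<in> H. commutator G y h \<in> N}"
    then have "commutator G y a \<otimes> (a \<otimes> commutator G y b \<otimes> inv a) \<in> N"
      using invariant_underD[OF Ninv] Ncl by blast
    moreover have "a \<in> carrier G" "b \<in> carrier G" "a \<otimes> b \<in> H"
      using a b c subgroup.m_closed[OF H] by auto
    ultimately show "a \<otimes> b \<in> {h \<in> H. commutator G y h \<in> N}"
      using c(2)[OF y] by (simp add: word)
  qed
  have 1: "commutator G y h \<in> N" if "y \<in> Y" "h \<in> H" for y h
  proof -
    have yH: "y \<in> H" using that Y(2) lcs_subset by auto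
    have "S \<subseteq> {h \<in> H. commutator G y h \<in> N}"
      using SH that conj_closure_contains[OF H Zc] by (auto simp: N_def Z_def)
    then have "H \<subseteq> {h \<in> H. commutator G y h \<in> N}"
      by (rule generate_subgroup_incl[OF _ sub2[OF yH], of S, folded S(1)])
    then show ?thesis using that by auto
  qed
  \<comment> \<open>the preimage of the centre of \<open>H/N\<close>\<close>
  define T where "T = {x \<in> H. \<forall>h\<in>H. commutator G x h \<in> N}"
  have T: "subgroup T G"
  proof (rule subgroupI)
    show "T \<subseteq> carrier G" using c by (auto simp: T_def)
    have "\<one> \<in> T" using subgroup.one_closed[OF H] subgroup.one_closed[OF N] c(2)
      by (auto simp: T_def)
    then show "T \<noteq> {}" by auto
  next
    fix a assume a: "a \<in> T"
    then have aH: "a \<in> H" "inv a \<in> H" "a \<in> carrier G" using c subgroup.m_inv_closed[OF H] by (auto simp: T_def)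
    have "commutator G (inv a) h \<in> N" if h: "h \<in> H" for h
    proof -
      have "inv a \<otimes> inv (commutator G a h) \<otimes> inv (inv a) \<in> N"
        using a h invariant_underD[OF Ninv aH(2)] Ncl by (auto simp: T_def)
      then show ?thesis using aH c(2)[OF h] by (simp add: word)
    qed
    with aH show "inv a \<in> T" by (auto simp: T_def)
  next
    fix a b assume a: "a \<in> T" and b: "b \<in> T"
    then have ab: "a \<in> H" "b \<in> H" "a \<otimes> b \<in> H" "a \<in> carrier G" "b \<in> carrier G"
      using c subgroup.m_closed[OF H] by (auto simp: T_def)
    have "commutator G (a \<otimes> b) h \<in> N" if h: "h \<in> H" for h
    proof -
      have "(a \<otimes> commutator G b h \<otimes> inv a) \<otimes> commutator G a h \<in> N"
        using a b ab h invariant_underD[OF Ninv ab(1)] Ncl by (auto simp: T_def)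
      then show ?thesis using ab c(2)[OF h] by (simp add: word)
    qed
    with ab show "a \<otimes> b \<in> T" by (auto simp: T_def)
  qed
  have Tinv: "invariant_under G H T"
    unfolding invariant_under_def
  proof (intro ballI)
    fix k x assume k: "k \<in> H" and x: "x \<in> T"
    then have xH: "x \<in> H" by (auto simp: T_def)
    note c' = c(2)[OF k] c(2)[OF xH]
    have "commutator G (k \<otimes> x \<otimes> inv k) h \<in> N" if h: "h \<in> H" for h
    proof -
      have "inv k \<otimes> h \<otimes> k \<in> H"
        using H k h by (simp add: subgroup.m_closed subgroup.m_inv_closed)
      then have "k \<otimes> commutator G x (inv k \<otimes> h \<otimes> k) \<otimes> inv k \<in> N"
        using x k invariant_underD[OF Ninv] by (auto simp: T_def)
      then show ?thesis using c' c(2)[OF h] by (simp add: word)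
    qed
    moreover have "k \<otimes> x \<otimes> inv k \<in> H"
      using H k xH by (simp add: subgroup.m_closed subgroup.m_inv_closed)
    ultimately show "k \<otimes> x \<otimes> inv k \<in> T" by (auto simp: T_def)
  qed
  have "Y \<subseteq> T" using 1 subsetD[OF Y(2)] subsetD[OF lcs_subset[of n]] by (auto simp: T_def)
  then have "\<gamma> n \<subseteq> T" unfolding Y(3) using conj_closure_least[OF T Tinv] by simp
  then have "\<gamma> (Suc n) \<subseteq> N" unfolding lcs_Suc
    by (intro generate_subgroup_incl[OF _ N]) (auto simp: T_def)
  moreover have "N \<subseteq> \<gamma> (Suc n)"
    unfolding N_def by (rule conj_closure_least[OF lcs_subgroup lcs_invariant Zsub])
  moreover have "finite Z" unfolding Z_def using Y S by simp
  ultimately show ?case using Zsub by (auto simp: N_def)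
qed

end

end

section \<open>Polycyclic series\<close>

text \<open>\<open>polycyclic_over G D H\<close> says that \<open>H\<close> arises from \<open>D\<close> by adjoining one element after the other,
each normalizing the subgroup reached so far, so that the successive quotients are cyclic.
Both the maximal condition and the Noetherian property are proved by induction along such a series.\<close>

inductive polycyclic_over :: "('a, 'm) monoid_scheme \<Rightarrow> 'a set \<Rightarrow> 'a set \<Rightarrow> bool"
  for G D where
  base: "polycyclic_over G D D"
| step: "polycyclic_over G D H \<Longrightarrow> t \<in> carrier G \<Longrightarrow>
    \<forall>h\<in>H. t \<otimes>\<^bsub>G\<^esub> h \<otimes>\<^bsub>G\<^esub> inv\<^bsub>G\<^esub> t \<in> H \<and> inv\<^bsub>G\<^esub> t \<otimes>\<^bsub>G\<^esub> h \<otimes>\<^bsub>G\<^esub> t \<in> H \<Longrightarrow>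
    polycyclic_over G D (generate G (insert t H))"

context group
begin

lemma polycyclic_over_subgroup:
  assumes "polycyclic_over G D H" "subgroup D G"
  shows "subgroup H G \<and> D \<subseteq> H"
  using assms
proof induction
  case (step H t)
  then have "subgroup (generate G (insert t H)) G"
    by (intro generate_is_subgroup) (auto dest: subgroup.subset)
  then show ?case using step by (auto intro: generate.incl)
qed auto

lemma normalizing_pow:
  assumes H: "subgroup H G" and t: "t \<in> carrier G"
    and N: "\<forall>h\<in>H. t \<otimes> h \<otimes> inv t \<in> H \<and> inv t \<otimes> h \<otimes> t \<in> H" and h: "h \<in> H"
  shows "t [^] (i::int) \<otimes> h \<otimes> inv (t [^] i) \<in> H"
proof -
  have "invariant_under G (generate G {t}) H"
    using invariant_under_generate[of H "{t}"] subgroup.subset[OF H] t N by auto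
  moreover have "t [^] i \<in> generate G {t}" using generate_pow[OF t] by auto
  ultimately show ?thesis using h by (simp add: invariant_under_def)
qed

lemma generate_insert_normalizing:
  assumes H: "subgroup H G" and t: "t \<in> carrier G"
    and N: "\<forall>h\<in>H. t \<otimes> h \<otimes> inv t \<in> H \<and> inv t \<otimes> h \<otimes> t \<in> H"
    and x: "x \<in> generate G (insert t H)"
  shows "\<exists>h\<in>H. \<exists>i::int. x = h \<otimes> t [^] i"
proof -
  note c = subsetD[OF subgroup.subset[OF H]]
  note pow = normalizing_pow[OF H t N]
  have "h \<otimes> t [^] i \<otimes> (k \<otimes> t [^] j) = (h \<otimes> (t [^] i \<otimes> k \<otimes> inv (t [^] i))) \<otimes> t [^] (i + j)"
    if "h \<in> H" "k \<in> H" for h k and i j :: int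
    using c that t by (simp add: word int_pow_mult)
  moreover have "h \<otimes> (t [^] i \<otimes> k \<otimes> inv (t [^] i)) \<in> H" if "h \<in> H" "k \<in> H" for h k and i :: int
    using subgroup.m_closed[OF H] pow that by blast
  ultimately have mult: "\<exists>l\<in>H. \<exists>n::int. h \<otimes> t [^] i \<otimes> (k \<otimes> t [^] j) = l \<otimes> t [^] n"
    if "h \<in> H" "k \<in> H" for h k and i j :: int
    using that by blast
  from x show ?thesis
  proof induction
    case one
    show ?case using subgroup.one_closed[OF H] t by (intro bexI[of _ \<one>] exI[of _ 0]) auto
  next
    case (incl h)
    show ?case
    proof (cases "h \<in> H")
      case True then show ?thesis using c by (intro bexI[of _ h] exI[of _ 0]) auto
    next
      case False then show ?thesis using incl t subgroup.one_closed[OF H]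
        by (intro bexI[of _ \<one>] exI[of _ 1]) auto
    qed
  next
    case (inv h)
    show ?case
    proof (cases "h \<in> H")
      case True then show ?thesis using c subgroup.m_inv_closed[OF H]
        by (intro bexI[of _ "inv h"] exI[of _ 0]) auto
    next
      case False then show ?thesis using inv t subgroup.one_closed[OF H]
        by (intro bexI[of _ \<one>] exI[of _ "-1"]) (auto simp: int_pow_neg)
    qed
  next
    case (eng a b)
    then show ?case using mult by auto
  qed
qed

text \<open>Every subgroup between \<open>D\<close> and \<open>H\<close> is finitely generated over \<open>D\<close>, because subgroups of cyclic
groups are cyclic: if \<open>K\<close> meets a coset \<open>H t\<^sup>n\<close> with \<open>n > 0\<close>, then \<open>K\<close> is generated by
\<open>K \<inter> H\<close> and one element of \<open>K\<close> in such a coset with \<open>n\<close> minimal.\<close>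

lemma polycyclic_over_max:
  assumes "polycyclic_over G D H" "subgroup D G" "subgroup K G" "D \<subseteq> K" "K \<subseteq> H"
  shows "\<exists>Y. finite Y \<and> Y \<subseteq> K \<and> K = generate G (D \<union> Y)"
  using assms
proof (induction arbitrary: K)
  case base
  then have "K = generate G (D \<union> {})"
    using generate_subgroup_incl[of D K] by (auto intro: generate.incl)
  then show ?case by blast
next
  case (step H t)
  have H: "subgroup H G" "D \<subseteq> H" using polycyclic_over_subgroup[OF step.hyps(1)] step.prems by auto
  note t = step.hyps(2) and N = step.hyps(3)
  note pow = normalizing_pow[OF H(1) t N]
  note c = subsetD[OF subgroup.subset[OF H(1)]]
  note K = \<open>subgroup K G\<close>
  note Kcl = subgroup.m_closed[OF K] subgroup.m_inv_closed[OF K]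
  note Hcl = subgroup.m_closed[OF H(1)] subgroup.m_inv_closed[OF H(1)]
  have KH: "subgroup (K \<inter> H) G" using K H subgroups_Inter_pair by blast
  obtain Y where Y: "finite Y" "Y \<subseteq> K \<inter> H" "K \<inter> H = generate G (D \<union> Y)"
    using step.IH[OF step.prems(1) KH] step.prems H by (metis le_inf_iff inf_le2)
  \<comment> \<open>the positive exponents of \<open>t\<close> that occur in \<open>K\<close>\<close>
  define I where "I = {n::nat. 0 < n \<and> (\<exists>h\<in>H. h \<otimes> t [^] n \<in> K)}"
  have flip: "\<exists>h'\<in>H. inv (h \<otimes> inv (t [^] n)) = h' \<otimes> t [^] n" if "h \<in> H" for h and n :: nat
  proof -
    have "t [^] n \<otimes> inv h \<otimes> inv (t [^] n) \<in> H"
      using pow[of "inv h" "int n"] Hcl that by (simp add: int_pow_int)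
    moreover have "inv (h \<otimes> inv (t [^] n)) = (t [^] n \<otimes> inv h \<otimes> inv (t [^] n)) \<otimes> t [^] n"
      using c[OF that] t by (simp add: word)
    ultimately show ?thesis by blast
  qed
  have form: "\<exists>h\<in>H. \<exists>n::nat. k = h \<otimes> t [^] n \<or> k = h \<otimes> inv (t [^] n)" if "k \<in> K" for k
  proof -
    obtain h i where "h \<in> H" "k = h \<otimes> t [^] (i::int)"
      using generate_insert_normalizing[OF H(1) t N] \<open>k \<in> K\<close> step.prems by blast
    then show ?thesis using t
      by (cases i rule: int_cases2) (auto simp: int_pow_int int_pow_neg_int)
  qed
  show ?case
  proof (cases "I = {}")
    case True
    have "k \<in> H" if k: "k \<in> K" for k
    proof -
      obtain h and n :: nat where h: "h \<in> H" "k = h \<otimes> t [^] n \<or> k = h \<otimes> inv (t [^] n)"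
        using form[OF k] by auto
      have "n = 0"
      proof (rule ccontr)
        assume "n \<noteq> 0"
        then have n: "0 < n" by simp
        from h(2) show False
        proof
          assume "k = h \<otimes> t [^] n"
          then have "n \<in> I" using n h(1) k by (auto simp: I_def)
          then show False using True by simp
        next
          assume kk: "k = h \<otimes> inv (t [^] n)"
          obtain h' where "h' \<in> H" "inv k = h' \<otimes> t [^] n" using flip[OF h(1), of n] kk by auto
          then have "n \<in> I" using n Kcl(2)[OF k] by (auto simp: I_def)
          then show False using True by simp
        qed
      qed
      then show ?thesis using h c by auto
    qed
    then have "K \<inter> H = K" by auto
    then show ?thesis using Y by auto
  next
    case False
    define d where "d = (LEAST n. n \<in> I)"
    have dI: "d \<in> I" unfolding d_def using False by (auto intro: LeastI)
    then obtain h0 where h0: "h0 \<in> H" "h0 \<otimes> t [^] d \<in> K" and d0: "0 < d" by (auto simp: I_def)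
    define k0 where "k0 = h0 \<otimes> t [^] d"
    define J where "J = generate G (D \<union> (insert k0 Y))"
    have sub: "D \<union> (insert k0 Y) \<subseteq> K" using step.prems Y h0 by (auto simp: k0_def)
    then have J: "subgroup J G" unfolding J_def
      using subgroup.subset[OF K] by (intro generate_is_subgroup) auto
    have k0J: "k0 \<in> J" unfolding J_def by (intro generate.incl) auto
    have KHJ: "K \<inter> H \<subseteq> J" unfolding Y(3) J_def by (intro mono_generate) auto
    have pos: "h \<otimes> t [^] n \<in> J" if "h \<in> H" "h \<otimes> t [^] n \<in> K" for h and n :: nat
      using that
    proof (induction n arbitrary: h rule: less_induct)
      case (less n)
      show ?case
      proof (cases "n = 0")
        case True then show ?thesis using less KHJ c by auto
      next
        case False
        then have "n \<in> I" using less by (auto simp: I_def)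
        then have "d \<le> n" unfolding d_def by (rule Least_le)
        define m where "m = n - d"
        have n: "n = m + d" "m < n" using \<open>d \<le> n\<close> d0 by (auto simp: m_def)
        let ?h = "h \<otimes> (t [^] m \<otimes> inv h0 \<otimes> inv (t [^] m))"
        have eq: "h \<otimes> t [^] n \<otimes> inv k0 = ?h \<otimes> t [^] m"
          using c[OF less.prems(1)] c[OF h0(1)] t by (simp add: n(1) k0_def word flip: nat_pow_mult)
        have hH: "?h \<in> H"
          using pow[of "inv h0" "int m"] Hcl less.prems(1) h0 by (simp add: int_pow_int)
        have "?h \<otimes> t [^] m \<in> K" using Kcl less.prems(2) h0 by (simp flip: eq add: k0_def)
        then have "h \<otimes> t [^] n \<otimes> inv k0 \<in> J" using less.IH[OF n(2) hH] by (simp add: eq)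
        then have "h \<otimes> t [^] n \<otimes> inv k0 \<otimes> k0 \<in> J" using k0J subgroup.m_closed[OF J] by blast
        then show ?thesis
          using c[OF less.prems(1)] c[OF h0(1)] t by (simp add: k0_def word)
      qed
    qed
    have "K \<subseteq> J"
    proof
      fix k assume k: "k \<in> K"
      obtain h and n :: nat where h: "h \<in> H" "k = h \<otimes> t [^] n \<or> k = h \<otimes> inv (t [^] n)"
        using form[OF k] by auto
      from h(2) show "k \<in> J"
      proof
        assume "k = h \<otimes> t [^] n" then show ?thesis using pos[of h n] h(1) k by simp
      next
        assume kk: "k = h \<otimes> inv (t [^] n)"
        obtain h' where "h' \<in> H" "inv k = h' \<otimes> t [^] n" using flip[OF h(1), of n] kk by auto
        then have "inv k \<in> J" using pos[of h' n] Kcl(2)[OF k] by simp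
        then have "inv (inv k) \<in> J" by (rule subgroup.m_inv_closed[OF J])
        then show ?thesis using k subgroup.subset[OF K] by auto
      qed
    qed
    moreover have "J \<subseteq> K" unfolding J_def by (rule generate_subgroup_incl[OF sub K])
    ultimately show ?thesis using Y(1) sub by (intro exI[of _ "insert k0 Y"]) (auto simp: J_def)
  qed
qed

text \<open>Elements that are central in \<open>H\<close> modulo \<open>P\<close> can be adjoined in any order, since every
intermediate subgroup is again normal in \<open>H\<close>.\<close>

lemma polycyclic_over_adjoin_central:
  assumes H: "subgroup H G" and "finite Y" "Y \<subseteq> H"
    and P: "polycyclic_over G D P" "subgroup P G" "P \<subseteq> H" "invariant_under G H P"
    and comm: "\<And>y h. y \<in> Y \<Longrightarrow> h \<in> H \<Longrightarrow> commutator G y h \<in> P"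
  shows "polycyclic_over G D (generate G (P \<union> Y)) \<and> subgroup (generate G (P \<union> Y)) G \<and>
    generate G (P \<union> Y) \<subseteq> H \<and> invariant_under G H (generate G (P \<union> Y))"
  using assms(2,3) comm
proof (induction Y)
  case empty
  have "generate G P = P"
    using generate_subgroup_incl[OF _ P(2), of P] by (auto intro: generate.incl)
  then show ?case using P by simp
next
  case (insert y Y)
  let ?Q = "generate G (P \<union> Y)" and ?Q' = "generate G (P \<union> insert y Y)"
  have IH: "polycyclic_over G D ?Q" "subgroup ?Q G" "?Q \<subseteq> H" "invariant_under G H ?Q"
    using insert by auto
  note c = subsetD[OF subgroup.subset[OF H]]
  have sub: "P \<union> insert y Y \<subseteq> H" using P insert by auto
  then have subc: "P \<union> insert y Y \<subseteq> carrier G" using c by blast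
  have yH: "y \<in> H" "inv y \<in> H" using insert subgroup.m_inv_closed[OF H] by auto
  have "\<forall>h\<in>?Q. y \<otimes> h \<otimes> inv y \<in> ?Q \<and> inv y \<otimes> h \<otimes> y \<in> ?Q"
    using IH(4) yH c[OF yH(1)] unfolding invariant_under_def by (metis inv_inv)
  then have "polycyclic_over G D (generate G (insert y ?Q))"
    using polycyclic_over.step[OF IH(1)] c yH by auto
  moreover have "generate G (insert y ?Q) = ?Q'"
  proof
    have "insert y ?Q \<subseteq> ?Q'" using mono_generate[of "P \<union> Y" "P \<union> insert y Y"]
      by (auto intro: generate.incl)
    then show "generate G (insert y ?Q) \<subseteq> ?Q'"
      by (rule generate_subgroup_incl[OF _ generate_is_subgroup[OF subc]])
    show "?Q' \<subseteq> generate G (insert y ?Q)"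
      by (intro mono_generate) (auto intro: generate.incl)
  qed
  moreover have "subgroup ?Q' G" using generate_is_subgroup[OF subc] .
  moreover have "?Q' \<subseteq> H" by (rule generate_subgroup_incl[OF sub H])
  moreover have "invariant_under G H ?Q'"
    unfolding invariant_under_def
  proof (intro ballI)
    fix h r assume h: "h \<in> H" and r: "r \<in> ?Q'"
    note hc = c[OF h]
    have "h \<otimes> x \<otimes> inv h \<in> ?Q'" if x: "x \<in> P \<union> insert y Y" for x
    proof (cases "x \<in> P")
      case True
      then have "h \<otimes> x \<otimes> inv h \<in> P" using P(4) h by (simp add: invariant_under_def)
      then show ?thesis by (auto intro: generate.incl)
    next
      case False
      then have "commutator G x h \<in> P" using x h insert.prems by auto
      then have "inv (commutator G x h) \<in> ?Q'" "x \<in> ?Q'"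
        using x subgroup.m_inv_closed[OF P(2)] by (auto intro: generate.incl)
      then have "inv (commutator G x h) \<otimes> x \<in> ?Q'" by (rule generate.eng)
      then show ?thesis using c[OF h] subsetD[OF subc x] by (simp add: word)
    qed
    then show "h \<otimes> r \<otimes> inv h \<in> ?Q'"
      using generate_conj[OF generate_is_subgroup[OF subc] hc subc _ r] by blast
  qed
  ultimately show ?case by simp
qed

text \<open>The series climbs from \<open>D\<close> along the lower central series. Modulo the next term, each term is
central and generated by the finitely many elements of which it is the normal closure.\<close>

lemma polycyclic_over_nilpotent_quotient:
  assumes H: "subgroup H G" and S: "H = generate G S" "finite S" "S \<subseteq> carrier G"
    and D: "subgroup D G" "D \<subseteq> H" "invariant_under G H D"
    and n: "lower_central_series (G\<lparr>carrier := H\<rparr>) n \<subseteq> D"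
  shows "polycyclic_over G D H"
proof -
  let ?\<gamma> = "lower_central_series (G\<lparr>carrier := H\<rparr>)"
  have "\<exists>P. polycyclic_over G D P \<and> subgroup P G \<and> P \<subseteq> H \<and> invariant_under G H P \<and> ?\<gamma> (n - k) \<subseteq> P"
    if "k \<le> n" for k
    using that
  proof (induction k)
    case 0
    then show ?case using D n polycyclic_over.base[of G D] by auto
  next
    case (Suc k)
    then obtain P where P: "polycyclic_over G D P" "subgroup P G" "P \<subseteq> H" "invariant_under G H P"
      "?\<gamma> (n - k) \<subseteq> P" by auto
    have nk: "n - k = Suc (n - Suc k)" using Suc.prems by simp
    obtain Y where Y: "finite Y" "Y \<subseteq> ?\<gamma> (n - Suc k)" "?\<gamma> (n - Suc k) = conj_closure G H Y"
      using lcs_finitely_normally_generated[OF H S, of "n - Suc k"] by auto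
    have YH: "Y \<subseteq> H" using Y(2) lcs_subset[OF H, of "n - Suc k"] by auto
    have comm: "commutator G y h \<in> P" if "y \<in> Y" "h \<in> H" for y h
      using lcs_commutator[OF H, of y "n - Suc k" h] that Y(2) P(5) nk by auto
    note Q = polycyclic_over_adjoin_central[OF H Y(1) YH P(1-4) comm]
    have "?\<gamma> (n - Suc k) \<subseteq> generate G (P \<union> Y)"
      unfolding Y(3) using Q by (intro conj_closure_least) (auto intro: generate.incl)
    then show ?case using Q by blast
  qed
  from this[of n] obtain P where "polycyclic_over G D P" "P \<subseteq> H" "H \<subseteq> P" by auto
  then show ?thesis by (metis subset_antisym)
qed

end

section \<open>Subgroups of finite index\<close>

definition finite_index :: "('a, 'm) monoid_scheme \<Rightarrow> 'a set \<Rightarrow> bool" where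
  "finite_index G H \<longleftrightarrow> subgroup H G \<and>
     (\<exists>T. finite T \<and> T \<subseteq> carrier G \<and> (\<forall>g\<in>carrier G. \<exists>h\<in>H. \<exists>t\<in>T. g = h \<otimes>\<^bsub>G\<^esub> t))"

context group
begin

text \<open>A short form of Schreier's lemma. Any finite set \<open>T\<close> with \<open>G = H T\<close> and \<open>1 \<in> T\<close> will do in place of
a transversal. Write every product \<open>t s\<close> with \<open>t \<in> T\<close> and \<open>s\<close> a generator or its inverse
as \<open>f(t s) u\<close> with \<open>f(t s) \<in> H\<close> and \<open>u \<in> T\<close>. If \<open>J\<close> is generated by the elements \<open>f(t s)\<close> and by
\<open>T \<inter> H\<close>, then \<open>J T\<close> is closed under right multiplication by generators, so \<open>J T = G\<close> and
\<open>J = H\<close>.\<close>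

lemma finite_index_finitely_generated:
  assumes fi: "finite_index G H" and S: "finite S" "S \<subseteq> carrier G" "carrier G = generate G S"
  shows "\<exists>S'. finite S' \<and> S' \<subseteq> H \<and> H = generate G S'"
proof -
  obtain T0 where T0: "finite T0" "T0 \<subseteq> carrier G" "\<forall>g\<in>carrier G. \<exists>h\<in>H. \<exists>t\<in>T0. g = h \<otimes> t"
    and H: "subgroup H G" using fi by (auto simp: finite_index_def)
  note c = subsetD[OF subgroup.subset[OF H]]
  define T where "T = insert \<one> T0"
  have T: "finite T" "T \<subseteq> carrier G" "\<And>g. g \<in> carrier G \<Longrightarrow> \<exists>h. h \<in> H \<and> (\<exists>t\<in>T. g = h \<otimes> t)"
    using T0 by (simp_all add: T_def) blast
  define f where "f = (\<lambda>g. SOME h. h \<in> H \<and> (\<exists>t\<in>T. g = h \<otimes> t))"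
  have f: "f g \<in> H \<and> (\<exists>t\<in>T. g = f g \<otimes> t)" if "g \<in> carrier G" for g
    unfolding f_def by (rule someI_ex[OF T(3)[OF that]])
  define S' where "S' = S \<union> (\<lambda>s. inv s) ` S"
  have S': "finite S'" "S' \<subseteq> carrier G" using S(1,2) by (auto simp: S'_def)
  define U where "U = (\<lambda>(t, s). f (t \<otimes> s)) ` (T \<times> S') \<union> (T \<inter> H)"
  have U: "finite U" "U \<subseteq> H" using S' T f by (auto simp: U_def subset_iff)
  define J where "J = generate G U"
  have Uc: "U \<subseteq> carrier G" using U c by auto
  have J: "subgroup J G" unfolding J_def by (rule generate_is_subgroup[OF Uc])
  have JH: "J \<subseteq> H" unfolding J_def by (rule generate_subgroup_incl[OF U(2) H])
  define JT where "JT = {j \<otimes> t |j t. j \<in> J \<and> t \<in> T}"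
  have JTc: "JT \<subseteq> carrier G" using JH c T by (auto simp: JT_def)
  have step: "x \<otimes> s \<in> JT" if x: "x \<in> JT" and s: "s \<in> S'" for x s
  proof -
    obtain j t where j: "j \<in> J" "t \<in> T" "x = j \<otimes> t" using x by (auto simp: JT_def)
    have ts: "t \<in> carrier G" "s \<in> carrier G" "j \<in> carrier G" using j s S' T JH c by auto
    obtain u where u: "u \<in> T" "t \<otimes> s = f (t \<otimes> s) \<otimes> u" "f (t \<otimes> s) \<in> H" using f[of "t \<otimes> s"] ts by auto
    have "f (t \<otimes> s) \<in> J" unfolding J_def U_def using j s by (intro generate.incl) auto
    then have "j \<otimes> f (t \<otimes> s) \<in> J" using j subgroup.m_closed[OF J] by blast
    moreover have "x \<otimes> s = j \<otimes> (f (t \<otimes> s) \<otimes> u)" using ts by (simp add: j(3) m_assoc flip: u(2))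
    then have "x \<otimes> s = (j \<otimes> f (t \<otimes> s)) \<otimes> u" using ts u T c by (simp add: m_assoc subset_iff)
    ultimately show ?thesis using u(1) by (auto simp: JT_def)
  qed
  have gen: "\<forall>x\<in>JT. x \<otimes> g \<in> JT" if "g \<in> generate G S" for g
    using that
  proof induction
    case one then show ?case using JTc by (auto simp: subset_iff)
  next
    case (incl h) then show ?case using step by (auto simp: S'_def)
  next
    case (inv h) then show ?case using step by (auto simp: S'_def)
  next
    case (eng a b)
    then have "a \<in> carrier G" "b \<in> carrier G" using S(3) by auto
    then show ?case using eng JTc by (auto simp: subset_iff simp flip: m_assoc)
  qed
  have "H \<subseteq> J"
  proof
    fix h assume h: "h \<in> H"
    have "\<one> \<otimes> \<one> \<in> JT" unfolding JT_def T_def using subgroup.one_closed[OF J] by blast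
    then have "\<one> \<in> JT" by simp
    then have "\<one> \<otimes> h \<in> JT" using gen[of h] c[OF h] S(3) by blast
    then obtain j t where j: "j \<in> J" "t \<in> T" "h = j \<otimes> t" using c[OF h] by (auto simp: JT_def)
    have "inv j \<otimes> h \<in> H" using j JH h subgroup.m_inv_closed[OF H] subgroup.m_closed[OF H] by blast
    moreover have "inv j \<otimes> h = t" using j JH c T by (simp add: subset_iff)
    ultimately have "t \<in> U" using j by (auto simp: U_def)
    then have "t \<in> J" unfolding J_def by (rule generate.incl)
    then show "h \<in> J" using j subgroup.m_closed[OF J] by blast
  qed
  then show ?thesis using JH U by (auto simp: J_def)
qed

text \<open>Finitely generated virtually nilpotent groups are finitely presented, stated for the kernel \<open>K\<close>
of a map from a finitely generated group. Up to finite index \<open>K\<close> is \<open>K \<inter> H\<close>; this contains a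
term of the lower central series of \<open>H\<close>, which is normally generated by finitely many
commutators, and \<open>K \<inter> H\<close> is finitely generated over that term because \<open>H\<close> is polycyclic over it.\<close>

theorem normal_closure_finite_if_virtually_nilpotent_quotient:
  assumes S: "finite S" "S \<subseteq> carrier G" "carrier G = generate G S"
    and fi: "finite_index G H" and n: "lower_central_series (G\<lparr>carrier := H\<rparr>) n \<subseteq> K"
    and K: "K \<lhd> G"
  shows "\<exists>Y. finite Y \<and> Y \<subseteq> K \<and> K = conj_closure G (carrier G) Y"
proof -
  obtain T where T: "finite T" "T \<subseteq> carrier G" "\<forall>g\<in>carrier G. \<exists>h\<in>H. \<exists>t\<in>T. g = h \<otimes> t"
    and H: "subgroup H G" using fi by (auto simp: finite_index_def)
  note Hc = subgroup.subset[OF H]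
  obtain S' where S': "finite S'" "S' \<subseteq> H" "H = generate G S'"
    using finite_index_finitely_generated[OF fi S] by auto
  have S'c: "S' \<subseteq> carrier G" using S' Hc by auto
  have Ks: "subgroup K G" and Kinv: "invariant_under G (carrier G) K"
    using K by (auto simp: normal_iff_invariant)
  let ?\<gamma> = "lower_central_series (G\<lparr>carrier := H\<rparr>) n"
  obtain Y0 where Y0: "finite Y0" "Y0 \<subseteq> ?\<gamma>" "?\<gamma> = conj_closure G H Y0"
    using lcs_finitely_normally_generated[OF H S'(3,1) S'c] by blast
  have poly: "polycyclic_over G ?\<gamma> H"
    using polycyclic_over_nilpotent_quotient[OF H S'(3,1) S'c lcs_subgroup[OF H]
      lcs_subset[OF H] lcs_invariant[OF H]] by blast
  have "subgroup (K \<inter> H) G" using Ks H subgroups_Inter_pair by blast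
  then obtain Y1 where Y1: "finite Y1" "Y1 \<subseteq> K \<inter> H" "K \<inter> H = generate G (?\<gamma> \<union> Y1)"
    using polycyclic_over_max[OF poly lcs_subgroup[OF H], of "K \<inter> H"] n lcs_subset[OF H, of n]
    by (metis le_inf_iff inf_le2)
  \<comment> \<open>one representative in \<open>K\<close> for each coset of \<open>H\<close> that meets \<open>K\<close>; for other \<open>t\<close> the choice is arbitrary\<close>
  define f where "f = (\<lambda>t. SOME k. k \<in> K \<and> (\<exists>h\<in>H. k = h \<otimes> t))"
  have f: "f t \<in> K \<and> (\<exists>h\<in>H. f t = h \<otimes> t)" if "k \<in> K" "h \<in> H" "k = h \<otimes> t" for t k h
    unfolding f_def by (rule someI[of _ k]) (use that in auto)
  define Y where "Y = Y0 \<union> Y1 \<union> (f ` T \<inter> K)"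
  have Y: "finite Y" "Y \<subseteq> K" using Y0 Y1 T n by (auto simp: Y_def)
  have Yc: "Y \<subseteq> carrier G" using Y subgroup.subset[OF Ks] by auto
  define N where "N = conj_closure G (carrier G) Y"
  have N: "subgroup N G" "invariant_under G (carrier G) N"
    using conj_closure_normal[OF Yc] by (auto simp: normal_iff_invariant N_def)
  have YN: "Y \<subseteq> N" unfolding N_def by (rule conj_closure_contains[OF subgroup_self Yc])
  have "?\<gamma> \<subseteq> N" unfolding Y0(3)
    using YN by (intro conj_closure_least[OF N(1) invariant_under_mono[OF N(2) Hc]]) (auto simp: Y_def)
  then have "K \<inter> H \<subseteq> N" unfolding Y1(3)
    using YN by (intro generate_subgroup_incl[OF _ N(1)]) (auto simp: Y_def)
  have "K \<subseteq> N"
  proof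
    fix k assume k: "k \<in> K"
    then have kc: "k \<in> carrier G" using subgroup.subset[OF Ks] by auto
    then obtain h t where ht: "h \<in> H" "t \<in> T" "k = h \<otimes> t" using T(3) by blast
    obtain h' where h': "h' \<in> H" "f t = h' \<otimes> t" "f t \<in> K" using f[OF k ht(1,3)] by auto
    have cc: "h \<in> carrier G" "h' \<in> carrier G" "t \<in> carrier G" using ht h' Hc T by auto
    have "k \<otimes> inv (f t) \<in> K"
      using k h' Ks by (simp add: subgroup.m_closed subgroup.m_inv_closed)
    moreover have "k \<otimes> inv (f t) = h \<otimes> inv h'" using cc by (simp add: ht(3) h'(2) word)
    moreover have "h \<otimes> inv h' \<in> H"
      using ht h' H by (simp add: subgroup.m_closed subgroup.m_inv_closed)
    ultimately have "k \<otimes> inv (f t) \<in> N" using \<open>K \<inter> H \<subseteq> N\<close> by auto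
    moreover have "f t \<in> N" using YN ht h' by (auto simp: Y_def)
    ultimately have "k \<otimes> inv (f t) \<otimes> f t \<in> N" by (rule subgroup.m_closed[OF N(1)])
    then show "k \<in> N" using cc by (simp add: ht(3) h'(2) word)
  qed
  moreover have "N \<subseteq> K" unfolding N_def by (rule conj_closure_least[OF Ks Kinv Y(2)])
  ultimately show ?thesis using Y by (auto simp: N_def)
qed

end

section \<open>A Hilbert basis theorem for polycyclic groups\<close>

definition noetherian_under :: "('a, 'm) monoid_scheme \<Rightarrow> 'a set \<Rightarrow> 'a set \<Rightarrow> bool" where
  "noetherian_under G H V \<longleftrightarrow>
     (\<forall>R. subgroup R G \<and> R \<subseteq> V \<and> invariant_under G H R \<longrightarrow>
          (\<exists>Y. finite Y \<and> Y \<subseteq> R \<and> R = conj_closure G H Y))"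

text \<open>In additive notation, with \<open>t\<close> acting by conjugation, this is the sum of \<open>t\<^sup>i U\<close> for \<open>i < n\<close>:
the skew polynomials in \<open>t\<close> of degree less than \<open>n\<close> with coefficients in \<open>U\<close>.\<close>

primrec twisted_polynomials :: "('a, 'm) monoid_scheme \<Rightarrow> 'a \<Rightarrow> 'a set \<Rightarrow> nat \<Rightarrow> 'a set" where
  "twisted_polynomials G t U 0 = {\<one>\<^bsub>G\<^esub>}"
| "twisted_polynomials G t U (Suc n) =
     {u \<otimes>\<^bsub>G\<^esub> (t \<otimes>\<^bsub>G\<^esub> w \<otimes>\<^bsub>G\<^esub> inv\<^bsub>G\<^esub> t) |u w. u \<in> U \<and> w \<in> twisted_polynomials G t U n}"

text \<open>One step of a polycyclic series acting on the abelian normal subgroup \<open>M\<close>. Here \<open>U\<close> is an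
\<open>H\<close>-submodule of \<open>M\<close> and \<open>t\<close> normalizes \<open>H\<close>. Although \<open>t\<close> need not act on \<open>U\<close>, it permutes the
\<open>H\<close>-submodules of \<open>M\<close>, which is all that Hilbert's argument requires.\<close>

locale twisted_hilbert_basis = group +
  fixes M U H t
  assumes M: "subgroup M G" "invariant_under G (carrier G) M"
    and M_comm: "\<And>x y. x \<in> M \<Longrightarrow> y \<in> M \<Longrightarrow> x \<otimes> y = y \<otimes> x"
    and H: "subgroup H G"
    and t: "t \<in> carrier G"
    and t_normalizes: "\<forall>h\<in>H. t \<otimes> h \<otimes> inv t \<in> H \<and> inv t \<otimes> h \<otimes> t \<in> H"
    and U: "subgroup U G" "U \<subseteq> M" "invariant_under G H U"
begin

abbreviation \<sigma> where "\<sigma> x \<equiv> t \<otimes> x \<otimes> inv t"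
abbreviation W where "W \<equiv> twisted_polynomials G t U"
abbreviation K where "K \<equiv> generate G (insert t H)"

text \<open>Constant terms rather than leading coefficients are used: since \<open>t\<close> is invertible, a polynomial
without constant term can be divided by \<open>t\<close>, and constant terms are not twisted by powers of \<open>t\<close>.\<close>

definition constant_terms where "constant_terms n R = {u \<in> U. \<exists>w\<in>W n. u \<otimes> \<sigma> w \<in> R}"

lemmas in_carrier = subsetD[OF subgroup.subset[OF H]] subsetD[OF subgroup.subset[OF M(1)]]
lemmas M_closed = subgroup.m_closed[OF M(1)] subgroup.m_inv_closed[OF M(1)]
lemmas H_closed = subgroup.m_closed[OF H] subgroup.m_inv_closed[OF H]
lemmas U_closed = subgroup.m_closed[OF U(1)] subgroup.m_inv_closed[OF U(1)]

lemma \<sigma>_M: "x \<in> M \<Longrightarrow> \<sigma> x \<in> M"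
  using M(2) t by (simp add: invariant_under_def)

lemma \<sigma>_mult: "x \<in> M \<Longrightarrow> y \<in> M \<Longrightarrow> \<sigma> (x \<otimes> y) = \<sigma> x \<otimes> \<sigma> y"
  using in_carrier(2) t by (simp add: word)

lemma \<sigma>_inv: "x \<in> M \<Longrightarrow> \<sigma> (inv x) = inv (\<sigma> x)"
  using in_carrier(2) t by (simp add: word)

lemma pair_mult:
  assumes "u \<in> U" "v \<in> U" "x \<in> M" "y \<in> M"
  shows "(u \<otimes> \<sigma> x) \<otimes> (v \<otimes> \<sigma> y) = (u \<otimes> v) \<otimes> \<sigma> (x \<otimes> y)"
proof -
  have uv: "u \<in> M" "v \<in> M" using assms U by auto
  note c = in_carrier(2)[OF uv(1)] in_carrier(2)[OF uv(2)] in_carrier(2)[OF \<sigma>_M[OF assms(3)]]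
     in_carrier(2)[OF \<sigma>_M[OF assms(4)]]
  have "(u \<otimes> \<sigma> x) \<otimes> (v \<otimes> \<sigma> y) = u \<otimes> (\<sigma> x \<otimes> v) \<otimes> \<sigma> y"
    using c by (simp only: m_assoc m_closed)
  also have "\<sigma> x \<otimes> v = v \<otimes> \<sigma> x" using M_comm[OF \<sigma>_M[OF assms(3)] uv(2)] .
  also have "u \<otimes> (v \<otimes> \<sigma> x) \<otimes> \<sigma> y = (u \<otimes> v) \<otimes> (\<sigma> x \<otimes> \<sigma> y)"
    using c by (simp only: m_assoc m_closed)
  finally show ?thesis by (simp only: \<sigma>_mult[OF assms(3,4)])
qed

lemma pair_inv:
  assumes "u \<in> U" "x \<in> M"
  shows "inv (u \<otimes> \<sigma> x) = inv u \<otimes> \<sigma> (inv x)"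
proof -
  have uv: "u \<in> M" using assms U by auto
  note c = in_carrier(2)[OF uv(1)] in_carrier(2)[OF \<sigma>_M[OF assms(2)]]
  have "inv (u \<otimes> \<sigma> x) = inv (\<sigma> x \<otimes> u)" using M_comm[OF \<sigma>_M[OF assms(2)] uv] by simp
  also have "\<dots> = inv u \<otimes> inv (\<sigma> x)" using c by (simp only: inv_mult_group)
  finally show ?thesis using \<sigma>_inv[OF assms(2)] by simp
qed

lemma pair_conj:
  assumes "u \<in> U" "x \<in> M" "h \<in> H"
  shows "h \<otimes> (u \<otimes> \<sigma> x) \<otimes> inv h =
    (h \<otimes> u \<otimes> inv h) \<otimes> \<sigma> ((inv t \<otimes> h \<otimes> t) \<otimes> x \<otimes> inv (inv t \<otimes> h \<otimes> t))"
  using in_carrier(1)[OF assms(3)] in_carrier(2)[OF assms(2)] in_carrier(2)[of u] assms(1) U(2) t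
  by (simp add: word subset_iff)

lemma W_subset: "W n \<subseteq> M"
proof (induction n)
  case 0 then show ?case using subgroup.one_closed[OF M(1)] by simp
next
  case (Suc n) have "u \<otimes> \<sigma> w \<in> M" if "u \<in> U" "w \<in> W n" for u w
    using that M_closed(1)[OF subsetD[OF U(2)] \<sigma>_M[OF subsetD[OF Suc]]] by blast
  then show ?case by auto
qed

lemma W_subgroup_invariant: "subgroup (W n) G \<and> invariant_under G H (W n)"
proof (induction n)
  case 0
  have "subgroup {\<one>} G" using one_is_normal normal_imp_subgroup by blast
  then show ?case using in_carrier by (auto simp: invariant_under_def)
next
  case (Suc n)
  then have W: "subgroup (W n) G" "invariant_under G H (W n)" by auto
  note Wn = subsetD[OF W_subset]
  note U1 = subgroup.one_closed[OF U(1)] subgroup.one_closed[OF W(1)]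
  have "subgroup (W (Suc n)) G"
  proof (rule subgroupI)
    show "W (Suc n) \<subseteq> carrier G" using W_subset[of "Suc n"] in_carrier by auto
    show "W (Suc n) \<noteq> {}" using U1 by auto
  next
    fix a assume "a \<in> W (Suc n)"
    then obtain u w where a: "a = u \<otimes> \<sigma> w" "u \<in> U" "w \<in> W n" by auto
    then have "inv a = inv u \<otimes> \<sigma> (inv w)" using pair_inv Wn by simp
    moreover have "inv u \<in> U" "inv w \<in> W n"
      using a U_closed subgroup.m_inv_closed[OF W(1)] by auto
    ultimately show "inv a \<in> W (Suc n)" by auto
  next
    fix a b assume "a \<in> W (Suc n)" "b \<in> W (Suc n)"
    then obtain u w v x where a: "a = u \<otimes> \<sigma> w" "u \<in> U" "w \<in> W n"
      and b: "b = v \<otimes> \<sigma> x" "v \<in> U" "x \<in> W n" by auto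
    then have "a \<otimes> b = (u \<otimes> v) \<otimes> \<sigma> (w \<otimes> x)" using pair_mult Wn by simp
    moreover have "u \<otimes> v \<in> U" "w \<otimes> x \<in> W n"
      using a b U_closed subgroup.m_closed[OF W(1)] by auto
    ultimately show "a \<otimes> b \<in> W (Suc n)" by auto
  qed
  moreover have "invariant_under G H (W (Suc n))"
    unfolding invariant_under_def
  proof (intro ballI)
    fix h a assume h: "h \<in> H" and "a \<in> W (Suc n)"
    then obtain u w where a: "a = u \<otimes> \<sigma> w" "u \<in> U" "w \<in> W n" by auto
    have "h \<otimes> u \<otimes> inv h \<in> U" using U(3) h a by (simp add: invariant_under_def)
    moreover have "(inv t \<otimes> h \<otimes> t) \<otimes> w \<otimes> inv (inv t \<otimes> h \<otimes> t) \<in> W n"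
      using invariant_underD[OF W(2) _ a(3)] t_normalizes h by blast
    ultimately show "h \<otimes> a \<otimes> inv h \<in> W (Suc n)"
      using pair_conj[OF a(2) _ h, of w] Wn[OF a(3)] a(1) by auto
  qed
  ultimately show ?case by simp
qed

lemmas W_subgroup = W_subgroup_invariant[THEN conjunct1]
lemmas W_invariant = W_subgroup_invariant[THEN conjunct2]
lemmas W_one = subgroup.one_closed[OF W_subgroup]

lemma W_Suc_mono: "W n \<subseteq> W (Suc n)"
proof (induction n)
  case 0
  have "\<one> = \<one> \<otimes> \<sigma> \<one>" using t by simp
  then show ?case using subgroup.one_closed[OF U(1)] by auto
next
  case (Suc n) then show ?case by auto
qed

lemma W_mono: "m \<le> n \<Longrightarrow> W m \<subseteq> W n"
  using W_Suc_mono by (rule lift_Suc_mono_le)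

lemma \<sigma>_W: "w \<in> W n \<Longrightarrow> \<sigma> w \<in> W (Suc n)"
proof -
  assume w: "w \<in> W n"
  then have "\<sigma> w = \<one> \<otimes> \<sigma> w" using W_subset in_carrier(2) t by (auto simp: subset_iff)
  then show ?thesis using w subgroup.one_closed[OF U(1)] by auto
qed

lemma constant_terms_mono: "m \<le> n \<Longrightarrow> constant_terms m R \<subseteq> constant_terms n R"
  using W_mono by (auto simp: constant_terms_def)

lemma constant_terms_submodule:
  assumes R: "subgroup R G" "invariant_under G H R"
  shows "subgroup (constant_terms n R) G" "invariant_under G H (constant_terms n R)"
proof -
  note Wn = subsetD[OF W_subset]
  show "subgroup (constant_terms n R) G"
  proof (rule subgroupI)
    show "constant_terms n R \<subseteq> carrier G" using U in_carrier by (auto simp: constant_terms_def)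
    have "\<one> \<otimes> \<sigma> \<one> \<in> R" using t subgroup.one_closed[OF R(1)] by simp
    then have "\<one> \<in> constant_terms n R"
      using W_one subgroup.one_closed[OF U(1)] by (auto simp: constant_terms_def)
    then show "constant_terms n R \<noteq> {}" by auto
  next
    fix u assume "u \<in> constant_terms n R"
    then obtain w where u: "u \<in> U" "w \<in> W n" "u \<otimes> \<sigma> w \<in> R" by (auto simp: constant_terms_def)
    have "inv (u \<otimes> \<sigma> w) \<in> R" using u subgroup.m_inv_closed[OF R(1)] by simp
    then have "inv u \<otimes> \<sigma> (inv w) \<in> R" using pair_inv u Wn by simp
    then show "inv u \<in> constant_terms n R"
      using u U_closed subgroup.m_inv_closed[OF W_subgroup] by (auto simp: constant_terms_def)
  next
    fix u v assume "u \<in> constant_terms n R" "v \<in> constant_terms n R"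
    then obtain w x where u: "u \<in> U" "w \<in> W n" "u \<otimes> \<sigma> w \<in> R"
      and v: "v \<in> U" "x \<in> W n" "v \<otimes> \<sigma> x \<in> R" by (auto simp: constant_terms_def)
    have "(u \<otimes> \<sigma> w) \<otimes> (v \<otimes> \<sigma> x) \<in> R" using u v subgroup.m_closed[OF R(1)] by simp
    then have "(u \<otimes> v) \<otimes> \<sigma> (w \<otimes> x) \<in> R" using pair_mult u v Wn by simp
    then show "u \<otimes> v \<in> constant_terms n R"
      using u v U_closed subgroup.m_closed[OF W_subgroup] by (auto simp: constant_terms_def)
  qed
  show "invariant_under G H (constant_terms n R)"
    unfolding invariant_under_def
  proof (intro ballI)
    fix h u assume h: "h \<in> H" and "u \<in> constant_terms n R"
    then obtain w where u: "u \<in> U" "w \<in> W n" "u \<otimes> \<sigma> w \<in> R" by (auto simp: constant_terms_def)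
    let ?w = "(inv t \<otimes> h \<otimes> t) \<otimes> w \<otimes> inv (inv t \<otimes> h \<otimes> t)"
    have "h \<otimes> u \<otimes> inv h \<in> U" using U(3) h u by (simp add: invariant_under_def)
    moreover have "?w \<in> W n"
      using invariant_underD[OF W_invariant _ u(2)] t_normalizes h by blast
    moreover have "h \<otimes> (u \<otimes> \<sigma> w) \<otimes> inv h \<in> R" using invariant_underD[OF R(2) h u(3)] .
    then have "(h \<otimes> u \<otimes> inv h) \<otimes> \<sigma> ?w \<in> R" using pair_conj[OF u(1) Wn[OF u(2)] h] by simp
    ultimately show "h \<otimes> u \<otimes> inv h \<in> constant_terms n R"
      unfolding constant_terms_def by blast
  qed
qed

text \<open>The union over all \<open>n\<close> is an \<open>H\<close>-submodule of the Noetherian module \<open>U\<close>, hence generated by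
finitely many elements, and these already occur together at a finite stage.\<close>

lemma constant_terms_stabilize:
  assumes noeth: "noetherian_under G H U" and R: "subgroup R G" "invariant_under G H R"
  shows "\<exists>N. \<forall>n. constant_terms n R \<subseteq> constant_terms N R"
proof -
  let ?L = "\<Union>n. constant_terms n R"
  note sub = constant_terms_submodule[OF R]
  have L: "subgroup ?L G"
  proof (rule subgroupI)
    show "?L \<subseteq> carrier G" using subgroup.subset[OF sub(1)] by blast
    show "?L \<noteq> {}" using subgroup.one_closed[OF sub(1)] by blast
    show "inv a \<in> ?L" if "a \<in> ?L" for a using that subgroup.m_inv_closed[OF sub(1)] by blast
    show "a \<otimes> b \<in> ?L" if ab: "a \<in> ?L" "b \<in> ?L" for a b
    proof -
      obtain m n where "a \<in> constant_terms m R" "b \<in> constant_terms n R" using ab by blast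
      then have "a \<in> constant_terms (m + n) R" "b \<in> constant_terms (m + n) R"
        using constant_terms_mono[of m "m + n"] constant_terms_mono[of n "m + n"] by auto
      then show ?thesis using subgroup.m_closed[OF sub(1)] by blast
    qed
  qed
  have "invariant_under G H ?L" using sub(2) by (fastforce simp: invariant_under_def)
  moreover have "?L \<subseteq> U" by (auto simp: constant_terms_def)
  ultimately obtain Y where Y: "finite Y" "Y \<subseteq> ?L" "?L = conj_closure G H Y"
    using noeth[unfolded noetherian_under_def, rule_format, of ?L] L by auto
  have "\<forall>y\<in>Y. \<exists>n. y \<in> constant_terms n R" using Y(2) by auto
  then obtain f where f: "\<forall>y\<in>Y. y \<in> constant_terms (f y) R" by metis
  define N where "N = sum f Y"
  have "Y \<subseteq> constant_terms N R"
  proof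
    fix y assume y: "y \<in> Y"
    then have "f y \<le> N" unfolding N_def using Y(1) by (intro member_le_sum) auto
    then show "y \<in> constant_terms N R" using f y constant_terms_mono by blast
  qed
  then have "?L \<subseteq> constant_terms N R"
    unfolding Y(3) by (rule conj_closure_least[OF sub])
  then show ?thesis by blast
qed

lemma K_subgroup: "subgroup K G"
  using t subgroup.subset[OF H] by (intro generate_is_subgroup) auto

lemma t_in_K: "t \<in> K" and H_sub_K: "H \<subseteq> K"
  by (auto intro: generate.incl)

text \<open>The module generated by \<open>F\<close> over \<open>H\<close> and \<open>t\<close> consists of Laurent polynomials, and these become
polynomials after multiplication by a power of \<open>t\<close>.\<close>

lemma generated_by_eventual_polynomials:
  assumes F: "F \<subseteq> U" and v: "v \<in> conj_closure G K F"
  shows "\<exists>(m::nat) n. t [^] m \<otimes> v \<otimes> inv (t [^] m) \<in> W n"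
proof -
  define E where "E = {v \<in> carrier G. \<exists>(m::nat) n. t [^] m \<otimes> v \<otimes> inv (t [^] m) \<in> W n}"
  have Ec: "E \<subseteq> carrier G" by (auto simp: E_def)
  \<comment> \<open>a common power of \<open>t\<close> serves for two elements at once\<close>
  have up: "t [^] (m + j) \<otimes> v \<otimes> inv (t [^] (m + j)) \<in> W (n + j)"
    if "v \<in> carrier G" "t [^] m \<otimes> v \<otimes> inv (t [^] m) \<in> W n" for v m n and j :: nat
  proof (induction j)
    case 0 then show ?case using that by simp
  next
    case (Suc j)
    have "t [^] (m + Suc j) = t \<otimes> t [^] (m + j)" using t nat_pow_Suc2 by simp
    then have "t [^] (m + Suc j) \<otimes> v \<otimes> inv (t [^] (m + Suc j)) = \<sigma> (t [^] (m + j) \<otimes> v \<otimes> inv (t [^] (m + j)))"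
      using t that(1) by (simp add: word del: nat_pow_Suc)
    then show ?case using \<sigma>_W[OF Suc] by simp
  qed
  have E: "subgroup E G"
  proof (rule subgroupI)
    show "E \<subseteq> carrier G" by (rule Ec)
    have "t [^] (0::nat) \<otimes> \<one> \<otimes> inv (t [^] (0::nat)) \<in> W 0" using t by simp
    then show "E \<noteq> {}" unfolding E_def by blast
  next
    fix a assume "a \<in> E"
    then obtain m n where a: "a \<in> carrier G" "t [^] (m::nat) \<otimes> a \<otimes> inv (t [^] m) \<in> W n" by (auto simp: E_def)
    then have "inv (t [^] m \<otimes> a \<otimes> inv (t [^] m)) \<in> W n" using subgroup.m_inv_closed[OF W_subgroup] by blast
    then have "t [^] m \<otimes> inv a \<otimes> inv (t [^] m) \<in> W n" using a(1) t by (simp add: word)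
    then show "inv a \<in> E" using a(1) unfolding E_def by auto
  next
    fix a b assume "a \<in> E" "b \<in> E"
    then obtain m n k l where a: "a \<in> carrier G" "t [^] (m::nat) \<otimes> a \<otimes> inv (t [^] m) \<in> W n"
      and b: "b \<in> carrier G" "t [^] (k::nat) \<otimes> b \<otimes> inv (t [^] k) \<in> W l" by (auto simp: E_def)
    let ?m = "m + k" and ?n = "n + l + m + k"
    have "t [^] ?m \<otimes> a \<otimes> inv (t [^] ?m) \<in> W ?n"
      using up[OF a, of k] W_mono[of "n + k" ?n] by auto
    moreover have "t [^] ?m \<otimes> b \<otimes> inv (t [^] ?m) \<in> W ?n"
      using up[OF b, of m] W_mono[of "l + m" ?n] by (auto simp: add.commute)
    ultimately have "(t [^] ?m \<otimes> a \<otimes> inv (t [^] ?m)) \<otimes> (t [^] ?m \<otimes> b \<otimes> inv (t [^] ?m)) \<in> W ?n"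
      by (rule subgroup.m_closed[OF W_subgroup])
    then have "t [^] ?m \<otimes> (a \<otimes> b) \<otimes> inv (t [^] ?m) \<in> W ?n"
      using a(1) b(1) t by (simp add: word)
    then show "a \<otimes> b \<in> E" using a(1) b(1) unfolding E_def by blast
  qed
  have H_E: "h \<otimes> a \<otimes> inv h \<in> E" if h: "h \<in> H" and a: "a \<in> E" for h a
  proof -
    obtain m n where a: "a \<in> carrier G" "t [^] (m::nat) \<otimes> a \<otimes> inv (t [^] m) \<in> W n"
      using a by (auto simp: E_def)
    let ?h = "t [^] m \<otimes> h \<otimes> inv (t [^] m)"
    have "?h \<in> H"
      using normalizing_pow[OF H t t_normalizes h, of "int m"] by (simp add: int_pow_int)
    then have "?h \<otimes> (t [^] m \<otimes> a \<otimes> inv (t [^] m)) \<otimes> inv ?h \<in> W n"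
      using invariant_underD[OF W_invariant _ a(2)] by blast
    then have "t [^] m \<otimes> (h \<otimes> a \<otimes> inv h) \<otimes> inv (t [^] m) \<in> W n"
      using a(1) t in_carrier(1)[OF h] by (simp add: word)
    then show ?thesis using a(1) in_carrier(1)[OF h] unfolding E_def by blast
  qed
  have t_E: "t \<otimes> a \<otimes> inv t \<in> E \<and> inv t \<otimes> a \<otimes> t \<in> E" if a: "a \<in> E" for a
  proof -
    obtain m n where a: "a \<in> carrier G" "t [^] (m::nat) \<otimes> a \<otimes> inv (t [^] m) \<in> W n"
      using a by (auto simp: E_def)
    have "t [^] m \<otimes> (t \<otimes> a \<otimes> inv t) \<otimes> inv (t [^] m) \<in> W (n + 1)"
      using up[OF a, of 1] a(1) t by (simp add: word)
    moreover have "t [^] (Suc m) \<otimes> (inv t \<otimes> a \<otimes> t) \<otimes> inv (t [^] (Suc m)) \<in> W n"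
      using a t by (simp add: word)
    ultimately show ?thesis using a(1) t unfolding E_def by blast
  qed
  have "invariant_under G K E"
    using t_E H_E H_closed in_carrier(1) t
    by (intro invariant_under_generate[OF Ec]) (auto, metis inv_inv)
  moreover have "F \<subseteq> E"
  proof
    fix f assume "f \<in> F"
    then have f: "f \<in> U" "f \<in> carrier G" using F U in_carrier(2) by auto
    then have "f \<otimes> \<sigma> \<one> \<in> W (Suc 0)" by auto
    then have "t [^] (0::nat) \<otimes> f \<otimes> inv (t [^] (0::nat)) \<in> W (Suc 0)" using f t by simp
    then show "f \<in> E" unfolding E_def using f by blast
  qed
  ultimately have "conj_closure G K F \<subseteq> E" using conj_closure_least[OF E] by simp
  then show ?thesis using v by (auto simp: E_def)
qed

text \<open>Hilbert's basis theorem. For each of the finitely many degree bounds up to the stage where the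
constant terms stabilize, pick polynomials in \<open>R\<close> whose constant terms generate all of them, and
let \<open>R'\<close> be the submodule that they generate. Given a polynomial in \<open>R\<close>, an element of
\<open>R'\<close> of no larger degree has the same constant term; the difference, divided by \<open>t\<close>,
has smaller degree. A general element of \<open>R\<close> is a polynomial up to a power of \<open>t\<close>.\<close>

theorem noetherian_extension:
  assumes noeth: "noetherian_under G H U" and F: "F \<subseteq> U"
  shows "noetherian_under G K (conj_closure G K F)"
  unfolding noetherian_under_def
proof (intro allI impI)
  fix R assume "subgroup R G \<and> R \<subseteq> conj_closure G K F \<and> invariant_under G K R"
  then have R: "subgroup R G" "R \<subseteq> conj_closure G K F" "invariant_under G K R" by auto
  note RH = invariant_under_mono[OF R(3) H_sub_K]
  note Wn = subsetD[OF W_subset]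
  note K_closed = subgroup.m_inv_closed[OF K_subgroup]
  obtain N where N: "\<And>n. constant_terms n R \<subseteq> constant_terms N R"
    using constant_terms_stabilize[OF noeth R(1) RH] by blast
  have "\<exists>Y. finite Y \<and> Y \<subseteq> constant_terms n R \<and> constant_terms n R = conj_closure G H Y" for n
  proof -
    have "constant_terms n R \<subseteq> U" by (auto simp: constant_terms_def)
    then show ?thesis using constant_terms_submodule[OF R(1) RH, of n]
      noeth[unfolded noetherian_under_def, rule_format, of "constant_terms n R"] by simp
  qed
  then have "\<forall>n. \<exists>Y. finite Y \<and> Y \<subseteq> constant_terms n R \<and> constant_terms n R = conj_closure G H Y"
    by (rule allI)
  from choice[OF this] obtain Y where
    "\<forall>n. finite (Y n) \<and> Y n \<subseteq> constant_terms n R \<and> constant_terms n R = conj_closure G H (Y n)"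
    by (rule exE)
  note Y = this[rule_format, THEN conjunct1] this[rule_format, THEN conjunct2, THEN conjunct1]
    this[rule_format, THEN conjunct2, THEN conjunct2]
  have "\<forall>p. \<exists>w. snd p \<in> Y (fst p) \<longrightarrow> w \<in> W (fst p) \<and> snd p \<otimes> \<sigma> w \<in> R"
  proof
    fix p
    show "\<exists>w. snd p \<in> Y (fst p) \<longrightarrow> w \<in> W (fst p) \<and> snd p \<otimes> \<sigma> w \<in> R"
    proof (cases "snd p \<in> Y (fst p)")
      case True
      then have "snd p \<in> constant_terms (fst p) R" using Y(2) by (rule subsetD[rotated])
      then show ?thesis unfolding constant_terms_def by blast
    qed simp
  qed
  from choice[OF this] obtain f' where
    f': "\<forall>p. snd p \<in> Y (fst p) \<longrightarrow> f' p \<in> W (fst p) \<and> snd p \<otimes> \<sigma> (f' p) \<in> R"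
    by (rule exE)
  define f where "f = (\<lambda>n y. f' (n, y))"
  have f: "f n y \<in> W n \<and> y \<otimes> \<sigma> (f n y) \<in> R" if "y \<in> Y n" for y n
    using f' that unfolding f_def by (metis fst_conv snd_conv)
  define Z where "Z = (\<Union>n\<in>{..N}. (\<lambda>y. y \<otimes> \<sigma> (f n y)) ` Y n)"
  have Z: "finite Z" "Z \<subseteq> R" using Y(1) f by (auto simp: Z_def)
  have Zc: "Z \<subseteq> carrier G" using Z subgroup.subset[OF R(1)] by auto
  define R' where "R' = conj_closure G K Z"
  have R': "subgroup R' G" "invariant_under G K R'"
    unfolding R'_def
    using conj_closure_subgroup[OF subgroup.subset[OF K_subgroup] Zc]
      conj_closure_invariant[OF K_subgroup Zc] by auto
  have ZR': "Z \<subseteq> R'" unfolding R'_def by (rule conj_closure_contains[OF K_subgroup Zc])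
  have R'R: "R' \<subseteq> R" unfolding R'_def by (rule conj_closure_least[OF R(1,3) Z(2)])
  have L: "constant_terms n R \<subseteq> constant_terms n R'" if "n \<le> N" for n
    unfolding Y(3)
  proof (rule conj_closure_least)
    show "subgroup (constant_terms n R') G" "invariant_under G H (constant_terms n R')"
      using constant_terms_submodule[OF R'(1) invariant_under_mono[OF R'(2) H_sub_K]] by auto
    show "Y n \<subseteq> constant_terms n R'"
    proof
      fix y assume y: "y \<in> Y n"
      then have "y \<otimes> \<sigma> (f n y) \<in> R'" using ZR' that by (auto simp: Z_def)
      moreover have "y \<in> U" using y Y(2)[of n] by (auto simp: constant_terms_def)
      ultimately show "y \<in> constant_terms n R'" using f[OF y] by (auto simp: constant_terms_def)
    qed
  qed
  have L': "\<exists>w\<in>W n. u \<otimes> \<sigma> w \<in> R'" if "u \<in> constant_terms n R" for u n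
  proof -
    have "u \<in> constant_terms (min n N) R" using that N[of n] by (cases "n \<le> N") (auto simp: min_def)
    then have "u \<in> constant_terms (min n N) R'" using L[of "min n N"] by auto
    then show ?thesis using W_mono[of "min n N" n] by (auto simp: constant_terms_def)
  qed
  have poly: "R \<inter> W n \<subseteq> R'" for n
  proof (induction n)
    case 0 then show ?case using subgroup.one_closed[OF R'(1)] by auto
  next
    case (Suc n)
    show ?case
    proof
      fix r assume r: "r \<in> R \<inter> W (Suc n)"
      then obtain u w where uw: "r = u \<otimes> \<sigma> w" "u \<in> U" "w \<in> W n" by auto
      then have "u \<in> constant_terms n R" using r by (auto simp: constant_terms_def)
      then obtain w' where w': "w' \<in> W n" "u \<otimes> \<sigma> w' \<in> R'" using L' by blast
      have c: "u \<in> carrier G" "w \<in> carrier G" "w' \<in> carrier G"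
        using uw w' Wn U in_carrier(2) by blast+
      \<comment> \<open>the quotient by the approximating element of \<open>R'\<close>, divided by \<open>t\<close>\<close>
      define x where "x = inv w' \<otimes> w"
      have "inv (u \<otimes> \<sigma> w') \<otimes> r \<in> R"
        using r w' R'R subgroup.m_closed[OF R(1)] subgroup.m_inv_closed[OF R(1)] by blast
      then have "inv t \<otimes> (inv (u \<otimes> \<sigma> w') \<otimes> r) \<otimes> inv (inv t) \<in> R"
        using invariant_underD[OF R(3) K_closed[OF t_in_K]] by blast
      moreover have "inv t \<otimes> (inv (u \<otimes> \<sigma> w') \<otimes> r) \<otimes> inv (inv t) = x"
        using c t by (simp add: word uw(1) x_def)
      ultimately have "x \<in> R" by simp
      moreover have "x \<in> W n" unfolding x_def
        using uw w' subgroup.m_closed[OF W_subgroup] subgroup.m_inv_closed[OF W_subgroup] by blast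
      ultimately have "\<sigma> x \<in> R'" using Suc invariant_underD[OF R'(2) t_in_K] by blast
      then have "(u \<otimes> \<sigma> w') \<otimes> \<sigma> x \<in> R'" using w' subgroup.m_closed[OF R'(1)] by blast
      then show "r \<in> R'" using c t by (simp add: word uw(1) x_def)
    qed
  qed
  have "R \<subseteq> R'"
  proof
    fix r assume r: "r \<in> R"
    then have rc: "r \<in> carrier G" using subgroup.subset[OF R(1)] by auto
    obtain m :: nat and n where mn: "t [^] m \<otimes> r \<otimes> inv (t [^] m) \<in> W n"
      using generated_by_eventual_polynomials[OF F] R(2) r by blast
    have tm: "t [^] m \<in> K"
      using subgroup_int_pow_closed[OF K_subgroup t_in_K, of "int m"] by (simp add: int_pow_int)
    then have "t [^] m \<otimes> r \<otimes> inv (t [^] m) \<in> R'"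
      using invariant_underD[OF R(3) tm r] mn poly by blast
    then have "inv (t [^] m) \<otimes> (t [^] m \<otimes> r \<otimes> inv (t [^] m)) \<otimes> inv (inv (t [^] m)) \<in> R'"
      using invariant_underD[OF R'(2) K_closed[OF tm]] by blast
    then show "r \<in> R'" using rc t by (simp add: word)
  qed
  then have "R = conj_closure G K Z" using R'R by (simp add: R'_def)
  then show "\<exists>Y. finite Y \<and> Y \<subseteq> R \<and> R = conj_closure G K Y" using Z by blast
qed

end

context group
begin

text \<open>P. Hall's theorem that finitely generated modules over group rings of polycyclic groups are
Noetherian. At the bottom of the series \<open>D\<close> acts trivially, and there the claim is that subgroups
of finitely generated abelian groups are finitely generated; this is the maximal condition
for a series that adjoins the generators in \<open>F\<close> to the trivial group.\<close>

theorem noetherian_under_polycyclic: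
  assumes "polycyclic_over G D H" "subgroup D G"
    and M: "subgroup M G" "invariant_under G (carrier G) M"
    and M_comm: "\<And>x y. x \<in> M \<Longrightarrow> y \<in> M \<Longrightarrow> x \<otimes> y = y \<otimes> x"
    and D_comm: "\<And>d x. d \<in> D \<Longrightarrow> x \<in> M \<Longrightarrow> d \<otimes> x = x \<otimes> d"
    and F: "finite F" "F \<subseteq> M"
  shows "noetherian_under G H (conj_closure G H F)"
  using assms(1,2) F
proof (induction arbitrary: F)
  case base
  note c = subsetD[OF subgroup.subset[OF M(1)]] subsetD[OF subgroup.subset[OF base(1)]]
  have one: "subgroup {\<one>} G" using one_is_normal normal_imp_subgroup by blast
  have "d \<otimes> x \<otimes> inv d = x" if "d \<in> D" "x \<in> F" for d x
  proof -
    have x: "x \<in> M" using that base by auto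
    show ?thesis using c(1)[OF x] c(2)[OF that(1)] by (simp add: D_comm[OF that(1) x] m_assoc)
  qed
  then have "{d \<otimes> x \<otimes> inv d |d x. d \<in> D \<and> x \<in> F} \<subseteq> F" by auto
  then have V: "conj_closure G D F \<subseteq> generate G F"
    unfolding conj_closure_def by (rule mono_generate)
  have "invariant_under G M {\<one>}" using c by (auto simp: invariant_under_def)
  moreover have "commutator G x y \<in> {\<one>}" if "x \<in> F" "y \<in> M" for x y
  proof -
    have x: "x \<in> M" using that base by auto
    show ?thesis using M_comm[OF x that(2)] c(1)[OF x] c(1)[OF that(2)] by (simp add: word)
  qed
  ultimately have poly: "polycyclic_over G {\<one>} (generate G ({\<one>} \<union> F))"
    using polycyclic_over_adjoin_central[OF M(1) base(2,3) polycyclic_over.base one]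
      subgroup.one_closed[OF M(1)] by auto
  show ?case
    unfolding noetherian_under_def
  proof (intro allI impI)
    fix R assume "subgroup R G \<and> R \<subseteq> conj_closure G D F \<and> invariant_under G D R"
    then have R: "subgroup R G" "R \<subseteq> conj_closure G D F" "invariant_under G D R" by auto
    have "R \<subseteq> generate G ({\<one>} \<union> F)" using R(2) V mono_generate[of F "{\<one>} \<union> F"] by blast
    then obtain Y where Y: "finite Y" "Y \<subseteq> R" "R = generate G ({\<one>} \<union> Y)"
      using polycyclic_over_max[OF poly one R(1)] subgroup.one_closed[OF R(1)] by blast
    have Yc: "Y \<subseteq> carrier G" using Y subgroup.subset[OF R(1)] by auto
    note sub = conj_closure_subgroup[OF subgroup.subset[OF base(1)] Yc]
    have "{\<one>} \<union> Y \<subseteq> conj_closure G D Y"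
      using conj_closure_contains[OF base(1) Yc] subgroup.one_closed[OF sub] by auto
    then have "R \<subseteq> conj_closure G D Y"
      by (rule generate_subgroup_incl[OF _ sub, of "{\<one>} \<union> Y", folded Y(3)])
    then have "R = conj_closure G D Y" using conj_closure_least[OF R(1,3) Y(2)] by blast
    then show "\<exists>Y. finite Y \<and> Y \<subseteq> R \<and> R = conj_closure G D Y" using Y by blast
  qed
next
  case (step H t)
  have H: "subgroup H G" using polycyclic_over_subgroup[OF step.hyps(1) step.prems(1)] by simp
  have Fc: "F \<subseteq> carrier G" using step.prems subgroup.subset[OF M(1)] by auto
  let ?U = "conj_closure G H F"
  have U: "subgroup ?U G" "?U \<subseteq> M" "invariant_under G H ?U"
    using conj_closure_subgroup[OF subgroup.subset[OF H] Fc] conj_closure_invariant[OF H Fc]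
      conj_closure_least[OF M(1) invariant_under_mono[OF M(2) subgroup.subset[OF H]] step.prems(3)]
    by auto
  interpret twisted_hilbert_basis G M ?U H t
    by (intro twisted_hilbert_basis.intro twisted_hilbert_basis_axioms.intro group_axioms
        M M_comm H step.hyps(2,3) U)
  show ?case
    using noetherian_extension[OF step.IH[OF step.prems] conj_closure_contains[OF H Fc]] .
qed

end

section \<open>Virtually nilpotent quotients\<close>

text \<open>For normal \<open>N\<close> this says that \<open>G/N\<close> is virtually nilpotent. Avoiding the quotient makes it easy to
transport along homomorphisms.\<close>

definition virtually_nilpotent_modulo :: "('a, 'm) monoid_scheme \<Rightarrow> 'a set \<Rightarrow> bool" where
  "virtually_nilpotent_modulo G N \<longleftrightarrow>
     (\<exists>H n. finite_index G H \<and> lower_central_series (G\<lparr>carrier := H\<rparr>) n \<subseteq> N)"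

lemma virtually_nilpotent_modulo_mono:
  "virtually_nilpotent_modulo G N \<Longrightarrow> N \<subseteq> N' \<Longrightarrow> virtually_nilpotent_modulo G N'"
  unfolding virtually_nilpotent_modulo_def by blast

context group
begin

lemma lower_central_series_subgroup_mono:
  assumes H: "subgroup H G" and H': "subgroup H' G" and sub: "H \<subseteq> H'"
  shows "lower_central_series (G\<lparr>carrier := H\<rparr>) n \<subseteq> lower_central_series (G\<lparr>carrier := H'\<rparr>) n"
proof (induction n)
  case 0 then show ?case using sub by simp
next
  case (Suc n)
  then show ?case unfolding lcs_Suc[OF H] lcs_Suc[OF H']
    using sub by (intro mono_generate) blast
qed

text \<open>As representatives one takes an element of each nonempty intersection of a coset of \<open>H\<close> with a
coset of \<open>K\<close>.\<close>

lemma finite_index_Int: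
  assumes "finite_index G H" "finite_index G K"
  shows "finite_index G (H \<inter> K)"
proof -
  obtain S where S: "finite S" "\<forall>g\<in>carrier G. \<exists>h\<in>H. \<exists>s\<in>S. g = h \<otimes> s" "S \<subseteq> carrier G"
    and H: "subgroup H G" using assms(1) by (auto simp: finite_index_def)
  obtain T where T: "finite T" "\<forall>g\<in>carrier G. \<exists>k\<in>K. \<exists>t\<in>T. g = k \<otimes> t" "T \<subseteq> carrier G"
    and K: "subgroup K G" using assms(2) by (auto simp: finite_index_def)
  note c = subsetD[OF subgroup.subset[OF H]] subsetD[OF subgroup.subset[OF K]]
  define P where "P p x \<longleftrightarrow> x \<in> carrier G \<and> x \<otimes> inv (fst p) \<in> H \<and> x \<otimes> inv (snd p) \<in> K" for p x
  define f where "f = (\<lambda>p. SOME x. P p x)"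
  define R where "R = f ` (S \<times> T) \<inter> carrier G"
  have "\<exists>h\<in>H \<inter> K. \<exists>r\<in>R. g = h \<otimes> r" if g: "g \<in> carrier G" for g
  proof -
    obtain h s where hs: "h \<in> H" "s \<in> S" "g = h \<otimes> s" using S(2) g by blast
    obtain k t where kt: "k \<in> K" "t \<in> T" "g = k \<otimes> t" using T(2) g by blast
    have sc: "s \<in> carrier G" "t \<in> carrier G" using hs kt S T by auto
    have gs: "g \<otimes> inv s = h" using hs(3) c(1)[OF hs(1)] sc by (simp add: m_assoc)
    have gt: "g \<otimes> inv t = k" using kt(3) c(2)[OF kt(1)] sc by (simp add: m_assoc)
    define x where "x = f (s, t)"
    have "P (s, t) g" using g gs gt hs kt by (simp add: P_def)
    then have "P (s, t) x" unfolding x_def f_def by (rule someI)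
    then have x: "x \<in> carrier G" "x \<otimes> inv s \<in> H" "x \<otimes> inv t \<in> K" by (auto simp: P_def)
    have "(g \<otimes> inv s) \<otimes> inv (x \<otimes> inv s) \<in> H"
      using x hs gs H by (simp add: subgroup.m_closed subgroup.m_inv_closed)
    moreover have "(g \<otimes> inv t) \<otimes> inv (x \<otimes> inv t) \<in> K"
      using x kt gt K by (simp add: subgroup.m_closed subgroup.m_inv_closed)
    ultimately have "g \<otimes> inv x \<in> H \<inter> K" using g x(1) sc by (simp add: word)
    moreover have "x \<in> R" using x(1) hs kt by (auto simp: R_def x_def)
    moreover have "g = (g \<otimes> inv x) \<otimes> x" using g x(1) by (simp add: word)
    ultimately show ?thesis by blast
  qed
  moreover have "finite R" "R \<subseteq> carrier G" using S T by (auto simp: R_def)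
  ultimately show ?thesis unfolding finite_index_def using H K subgroups_Inter_pair by blast
qed

lemma virtually_nilpotent_modulo_Int:
  assumes "virtually_nilpotent_modulo G M" "virtually_nilpotent_modulo G N"
  shows "virtually_nilpotent_modulo G (M \<inter> N)"
proof -
  obtain H m where H: "finite_index G H" "lower_central_series (G\<lparr>carrier := H\<rparr>) m \<subseteq> M"
    using assms(1) by (auto simp: virtually_nilpotent_modulo_def)
  obtain K n where K: "finite_index G K" "lower_central_series (G\<lparr>carrier := K\<rparr>) n \<subseteq> N"
    using assms(2) by (auto simp: virtually_nilpotent_modulo_def)
  have s: "subgroup H G" "subgroup K G" using H K by (auto simp: finite_index_def)
  have HK: "finite_index G (H \<inter> K)" using finite_index_Int H K by simp
  then have sHK: "subgroup (H \<inter> K) G" by (simp add: finite_index_def)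
  let ?\<gamma> = "\<lambda>H. lower_central_series (G\<lparr>carrier := H\<rparr>)"
  have "?\<gamma> (H \<inter> K) (max m n) \<subseteq> ?\<gamma> H m"
    using lcs_antimono[OF sHK, of m "max m n"] lower_central_series_subgroup_mono[OF sHK s(1), of m] by auto
  moreover have "?\<gamma> (H \<inter> K) (max m n) \<subseteq> ?\<gamma> K n"
    using lcs_antimono[OF sHK, of n "max m n"] lower_central_series_subgroup_mono[OF sHK s(2), of n] by auto
  ultimately show ?thesis unfolding virtually_nilpotent_modulo_def using HK H K by blast
qed

lemma finite_index_if_finite_rcosets:
  assumes H: "subgroup H G" and fin: "finite (rcosets H)"
  shows "finite_index G H"
proof -
  have "rcosets H = (\<lambda>a. H #> a) ` carrier G" by (auto simp: RCOSETS_def)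
  then obtain T where T: "T \<subseteq> carrier G" "finite T" "rcosets H = (\<lambda>a. H #> a) ` T"
    using fin finite_subset_image[of "rcosets H" "\<lambda>a. H #> a" "carrier G"] by auto
  have "\<exists>h\<in>H. \<exists>t\<in>T. g = h \<otimes> t" if g: "g \<in> carrier G" for g
  proof -
    have "H #> g \<in> rcosets H" using g by (auto simp: RCOSETS_def)
    then obtain t where t: "t \<in> T" "H #> g = H #> t" using T(3) by auto
    then have "g \<in> H #> t" using rcos_self[OF g H] by simp
    then show ?thesis using t(1) by (auto simp: r_coset_def)
  qed
  then show ?thesis using H T by (auto simp: finite_index_def)
qed

end

context group_hom
begin

lemma hom_commutator:
  "x \<in> carrier G \<Longrightarrow> y \<in> carrier G \<Longrightarrow> h (commutator G x y) = commutator H (h x) (h y)"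
  by simp

lemma preimage_subgroup:
  assumes L: "subgroup L H"
  shows "subgroup {g \<in> carrier G. h g \<in> L} G"
proof (rule G.subgroupI)
  have "\<one> \<in> {g \<in> carrier G. h g \<in> L}" using subgroup.one_closed[OF L] by simp
  then show "{g \<in> carrier G. h g \<in> L} \<noteq> {}" by blast
qed (use L in \<open>auto simp: subgroup.m_closed subgroup.m_inv_closed\<close>)

lemma lower_central_series_image:
  assumes K: "subgroup K G"
  shows "lower_central_series (H\<lparr>carrier := h ` K\<rparr>) n = h ` lower_central_series (G\<lparr>carrier := K\<rparr>) n"
proof (induction n)
  case 0 then show ?case by simp
next
  case (Suc n)
  have hK: "subgroup (h ` K) H" using K by (rule subgroup_img_is_subgroup)
  let ?\<gamma> = "lower_central_series (G\<lparr>carrier := K\<rparr>) n"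
  note c = subsetD[OF G.lcs_carrier[OF K]] subsetD[OF subgroup.subset[OF K]]
  have "{commutator H x k |x k. x \<in> h ` ?\<gamma> \<and> k \<in> h ` K} = h ` {commutator G x k |x k. x \<in> ?\<gamma> \<and> k \<in> K}"
    (is "?A = ?B")
  proof
    show "?A \<subseteq> ?B"
    proof
      fix z assume "z \<in> ?A"
      then obtain x k where "x \<in> ?\<gamma>" "k \<in> K" "z = commutator H (h x) (h k)" by auto
      moreover from this have "z = h (commutator G x k)" using c by simp
      ultimately show "z \<in> ?B" by blast
    qed
    show "?B \<subseteq> ?A"
    proof
      fix z assume "z \<in> ?B"
      then obtain x k where "x \<in> ?\<gamma>" "k \<in> K" "z = h (commutator G x k)" by auto
      moreover from this have "z = commutator H (h x) (h k)" using c by simp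
      ultimately show "z \<in> ?A" by blast
    qed
  qed
  moreover have "{commutator G x k |x k. x \<in> ?\<gamma> \<and> k \<in> K} \<subseteq> carrier G"
    using c by auto
  ultimately show ?case
    unfolding G.lcs_Suc[OF K] H.lcs_Suc[OF hK] Suc by (simp add: generate_img)
qed

lemma virtually_nilpotent_modulo_image:
  assumes surj: "h ` carrier G = carrier H" and N: "virtually_nilpotent_modulo G N"
  shows "virtually_nilpotent_modulo H (h ` N)"
proof -
  obtain K n T where K: "subgroup K G" "lower_central_series (G\<lparr>carrier := K\<rparr>) n \<subseteq> N"
    and T: "finite T" "T \<subseteq> carrier G" "\<forall>g\<in>carrier G. \<exists>k\<in>K. \<exists>t\<in>T. g = k \<otimes> t"
    using N by (auto simp: virtually_nilpotent_modulo_def finite_index_def)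
  have "\<exists>k\<in>h ` K. \<exists>t\<in>h ` T. g = k \<otimes>\<^bsub>H\<^esub> t" if "g \<in> carrier H" for g
  proof -
    obtain g' where g': "g' \<in> carrier G" "g = h g'" using surj \<open>g \<in> carrier H\<close> by auto
    then obtain k t where "k \<in> K" "t \<in> T" "g' = k \<otimes> t" using T by blast
    then show ?thesis using g' T(2) subgroup.subset[OF K(1)] by (auto simp: subset_iff)
  qed
  moreover have "finite (h ` T)" "h ` T \<subseteq> carrier H" using T by auto
  ultimately have "finite_index H (h ` K)"
    unfolding finite_index_def using subgroup_img_is_subgroup[OF K(1)] by blast
  moreover have "lower_central_series (H\<lparr>carrier := h ` K\<rparr>) n \<subseteq> h ` N"
    using lower_central_series_image[OF K(1)] K(2) by auto
  ultimately show ?thesis by (auto simp: virtually_nilpotent_modulo_def)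
qed

lemma virtually_nilpotent_modulo_preimage:
  assumes surj: "h ` carrier G = carrier H" and L: "virtually_nilpotent_modulo H L"
  shows "virtually_nilpotent_modulo G {g \<in> carrier G. h g \<in> L}"
proof -
  obtain K n T where K: "subgroup K H" "lower_central_series (H\<lparr>carrier := K\<rparr>) n \<subseteq> L"
    and T: "finite T" "T \<subseteq> carrier H" "\<forall>g\<in>carrier H. \<exists>k\<in>K. \<exists>t\<in>T. g = k \<otimes>\<^bsub>H\<^esub> t"
    using L by (auto simp: virtually_nilpotent_modulo_def finite_index_def)
  let ?K = "{g \<in> carrier G. h g \<in> K}"
  have sK: "subgroup ?K G" by (rule preimage_subgroup[OF K(1)])
  have hK: "h ` ?K = K"
  proof
    show "K \<subseteq> h ` ?K"
    proof
      fix k assume k: "k \<in> K"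
      then have "k \<in> h ` carrier G" using subgroup.subset[OF K(1)] surj by auto
      then show "k \<in> h ` ?K" using k by auto
    qed
  qed auto
  obtain T' where T': "T' \<subseteq> carrier G" "finite T'" "T = h ` T'"
    using finite_subset_image[OF T(1), of h "carrier G"] T(2) surj by auto
  have "\<exists>k\<in>?K. \<exists>t\<in>T'. g = k \<otimes> t" if g: "g \<in> carrier G" for g
  proof -
    obtain k t where kt: "k \<in> K" "t \<in> T'" "h g = k \<otimes>\<^bsub>H\<^esub> h t" using T(3)[rule_format, of "h g"] T'(3) g by auto
    have tc: "t \<in> carrier G" and kc: "k \<in> carrier H" using kt T' subgroup.subset[OF K(1)] by auto
    have "h (g \<otimes> inv t) = k" using g tc kc kt(3) by (simp add: H.word)
    then have "g \<otimes> inv t \<in> ?K" using g tc kt by simp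
    moreover have "g = g \<otimes> inv t \<otimes> t" using g tc by (simp add: G.word)
    ultimately show ?thesis using kt(2) by blast
  qed
  then have "finite_index G ?K" unfolding finite_index_def using sK T' by blast
  moreover have "h ` lower_central_series (G\<lparr>carrier := ?K\<rparr>) n \<subseteq> L"
    using lower_central_series_image[OF sK, of n] K(2) hK by simp
  then have "lower_central_series (G\<lparr>carrier := ?K\<rparr>) n \<subseteq> {g \<in> carrier G. h g \<in> L}"
    using G.lcs_carrier[OF sK, of n] by auto
  ultimately show ?thesis unfolding virtually_nilpotent_modulo_def by blast
qed

end

context group
begin

lemma group_hom_Mod:
  assumes "N \<lhd> G"
  shows "group_hom G (G Mod N) (\<lambda>a. N #> a)" "(\<lambda>a. N #> a) ` carrier G = carrier (G Mod N)"
  using assms normal.r_coset_hom_Mod[OF assms] normal.factorgroup_is_group[OF assms]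
  by (auto simp: group_hom_def group_hom_axioms_def carrier_FactGroup)

lemma virtually_nilpotent_modulo_if_Mod:
  assumes N: "N \<lhd> G" and vn: "virtually_nilpotent_group (G Mod N)"
  shows "virtually_nilpotent_modulo G N"
proof -
  interpret Q: group_hom G "G Mod N" "\<lambda>a. N #> a" by (rule group_hom_Mod(1)[OF N])
  obtain H n where H: "subgroup H (G Mod N)" "finite (rcosets\<^bsub>G Mod N\<^esub> H)"
    "lower_central_series ((G Mod N)\<lparr>carrier := H\<rparr>) n = {\<one>\<^bsub>(G Mod N)\<lparr>carrier := H\<rparr>\<^esub>}"
    using vn unfolding virtually_nilpotent_group_def nilpotent_group_def by blast
  have "virtually_nilpotent_modulo (G Mod N) {\<one>\<^bsub>G Mod N\<^esub>}"
    unfolding virtually_nilpotent_modulo_def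
    using Q.H.finite_index_if_finite_rcosets[OF H(1,2)] H(3) by (intro exI[of _ H] exI[of _ n]) simp
  then have "virtually_nilpotent_modulo G {g \<in> carrier G. N #> g \<in> {\<one>\<^bsub>G Mod N\<^esub>}}"
    by (rule Q.virtually_nilpotent_modulo_preimage[OF group_hom_Mod(2)[OF N]])
  moreover have "{g \<in> carrier G. N #> g \<in> {\<one>\<^bsub>G Mod N\<^esub>}} \<subseteq> N"
  proof
    fix g assume "g \<in> {g \<in> carrier G. N #> g \<in> {\<one>\<^bsub>G Mod N\<^esub>}}"
    then show "g \<in> N" using coset_join1[OF _ _ normal_imp_subgroup[OF N]] by simp
  qed
  ultimately show ?thesis by (rule virtually_nilpotent_modulo_mono)
qed

text \<open>The module \<open>M = B1 \<inter> B2\<close> is abelian, and \<open>G/M\<close> is virtually nilpotent because it embeds in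
\<open>G/B1 \<times> G/B2\<close>; so \<open>M\<close> is a finitely generated module. Both \<open>B1\<close> and \<open>B2\<close> act trivially on it, so
that the action is one of the virtually polycyclic group \<open>G/B1\<close>, and Hall's theorem
applies to the submodule \<open>R\<close>.\<close>

theorem normal_closure_finite_if_commuting:
  assumes fg: "finitely_generated_group G"
    and B: "B1 \<lhd> G" "B2 \<lhd> G" and comm: "\<And>x y. x \<in> B1 \<Longrightarrow> y \<in> B2 \<Longrightarrow> x \<otimes> y = y \<otimes> x"
    and vn: "virtually_nilpotent_modulo G B1" "virtually_nilpotent_modulo G B2"
    and R: "R \<lhd> G" "R \<subseteq> B1 \<inter> B2"
  shows "\<exists>Y. finite Y \<and> Y \<subseteq> R \<and> R = conj_closure G (carrier G) Y"
proof -
  obtain S where S: "finite S" "S \<subseteq> carrier G" "carrier G = generate G S"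
    using fg by (auto simp: finitely_generated_group_def)
  define M where "M = B1 \<inter> B2"
  have MG: "M \<lhd> G" unfolding M_def using B by (rule normal_subgroup_intersect)
  then have M: "subgroup M G" "invariant_under G (carrier G) M" by (auto simp: normal_iff_invariant)
  have Rs: "subgroup R G" "invariant_under G (carrier G) R" using R by (auto simp: normal_iff_invariant)
  have Bs: "subgroup B1 G" "invariant_under G (carrier G) B1" using B by (auto simp: normal_iff_invariant)
  obtain H' n' where H': "finite_index G H'" "lower_central_series (G\<lparr>carrier := H'\<rparr>) n' \<subseteq> M"
    using virtually_nilpotent_modulo_Int[OF vn] by (auto simp: virtually_nilpotent_modulo_def M_def)
  obtain F where F: "finite F" "F \<subseteq> M" "M = conj_closure G (carrier G) F"
    using normal_closure_finite_if_virtually_nilpotent_quotient[OF S H' MG] by blast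
  obtain H n where fi: "finite_index G H" and n: "lower_central_series (G\<lparr>carrier := H\<rparr>) n \<subseteq> B1"
    using vn(1) by (auto simp: virtually_nilpotent_modulo_def)
  obtain T where T: "finite T" "T \<subseteq> carrier G" "\<forall>g\<in>carrier G. \<exists>h\<in>H. \<exists>t\<in>T. g = h \<otimes> t"
    and H: "subgroup H G" using fi by (auto simp: finite_index_def)
  note Hc = subgroup.subset[OF H]
  obtain S' where S': "finite S'" "S' \<subseteq> H" "H = generate G S'"
    using finite_index_finitely_generated[OF fi S] by auto
  have S'c: "S' \<subseteq> carrier G" using S' Hc by auto
  have D: "subgroup (H \<inter> B1) G" using H Bs(1) subgroups_Inter_pair by blast
  have Dinv: "invariant_under G H (H \<inter> B1)"
    using invariant_under_mono[OF Bs(2) Hc] H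
    by (auto simp: invariant_under_def subgroup.m_closed subgroup.m_inv_closed)
  have poly: "polycyclic_over G (H \<inter> B1) H"
    using polycyclic_over_nilpotent_quotient[OF H S'(3,1) S'c D _ Dinv] n lcs_subset[OF H, of n] by auto
  \<comment> \<open>as a module over the subgroup \<open>H\<close> of finite index, \<open>M\<close> is generated by the translates of \<open>F\<close>\<close>
  define F' where "F' = (\<lambda>(t, x). t \<otimes> x \<otimes> inv t) ` (T \<times> F)"
  have F': "finite F'" "F' \<subseteq> M" using F(1,2) T M(2) by (auto simp: F'_def invariant_under_def subset_iff)
  then have F'c: "F' \<subseteq> carrier G" using subgroup.subset[OF M(1)] by auto
  have "noetherian_under G H (conj_closure G H F')"
    by (rule noetherian_under_polycyclic[OF poly D M _ _ F']) (use comm in \<open>auto simp: M_def\<close>)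
  moreover have "M \<subseteq> conj_closure G H F'"
    unfolding F(3) conj_closure_def
  proof (rule mono_generate, rule subsetI)
    fix z assume "z \<in> {g \<otimes> y \<otimes> inv g |g y. g \<in> carrier G \<and> y \<in> F}"
    then obtain g y where gy: "g \<in> carrier G" "y \<in> F" "z = g \<otimes> y \<otimes> inv g" by auto
    then obtain h t where ht: "h \<in> H" "t \<in> T" "g = h \<otimes> t" using T(3) by blast
    have "h \<in> carrier G" "t \<in> carrier G" "y \<in> carrier G"
      using ht Hc T F(2) subgroup.subset[OF M(1)] gy by auto
    then have "z = h \<otimes> (t \<otimes> y \<otimes> inv t) \<otimes> inv h" by (simp add: gy(3) ht(3) word)
    moreover have "t \<otimes> y \<otimes> inv t \<in> F'" unfolding F'_def using ht gy by force
    ultimately show "z \<in> {h \<otimes> y \<otimes> inv h |h y. h \<in> H \<and> y \<in> F'}" using ht(1) by blast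
  qed
  ultimately obtain Y where Y: "finite Y" "Y \<subseteq> R" "R = conj_closure G H Y"
    using Rs(1) invariant_under_mono[OF Rs(2) Hc] R(2) unfolding M_def noetherian_under_def
    by (meson subset_trans)
  have Yc: "Y \<subseteq> carrier G" using Y(2) subgroup.subset[OF Rs(1)] by auto
  have "R \<subseteq> conj_closure G (carrier G) Y"
    using mono_generate[of "{h \<otimes> y \<otimes> inv h |h y. h \<in> H \<and> y \<in> Y}"
        "{h \<otimes> y \<otimes> inv h |h y. h \<in> carrier G \<and> y \<in> Y}"] Hc
    unfolding Y(3)[unfolded conj_closure_def] conj_closure_def by blast
  then show ?thesis using Y conj_closure_least[OF Rs Y(2)] by blast
qed

text \<open>Modulo the commutators of \<open>B1\<close> with \<open>B2\<close> the preceding theorem applies. The conclusion is phrased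
through the normal subgroups \<open>N\<close> that contain these commutators and \<open>Y\<close>, since the intended \<open>N\<close> is
known to contain them for a reason of its own.\<close>

corollary normal_closure_finite_with_commutators:
  assumes fg: "finitely_generated_group G"
    and B: "B1 \<lhd> G" "B2 \<lhd> G"
    and vn: "virtually_nilpotent_modulo G B1" "virtually_nilpotent_modulo G B2"
    and R: "R \<lhd> G" "R \<subseteq> B1 \<inter> B2"
  shows "\<exists>Y. finite Y \<and> Y \<subseteq> R \<and>
    (\<forall>N. N \<lhd> G \<and> Y \<subseteq> N \<and> (\<forall>x\<in>B1. \<forall>y\<in>B2. commutator G x y \<in> N) \<longrightarrow> R \<subseteq> N)"
proof -
  obtain S where S: "finite S" "S \<subseteq> carrier G" "generate G S = carrier G"
    using fg by (auto simp: finitely_generated_group_def)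
  have Bc: "B1 \<subseteq> carrier G" "B2 \<subseteq> carrier G" using B normal_imp_subgroup subgroup.subset by blast+
  define C where "C = {commutator G x y |x y. x \<in> B1 \<and> y \<in> B2}"
  have Cc: "C \<subseteq> carrier G" using Bc by (auto simp: C_def subset_iff)
  define V where "V = conj_closure G (carrier G) C"
  have V: "V \<lhd> G" unfolding V_def by (rule conj_closure_normal[OF Cc])
  have CV: "C \<subseteq> V" unfolding V_def by (rule conj_closure_contains[OF subgroup_self Cc])
  let ?Q = "G Mod V" and ?\<pi> = "\<lambda>a. V #> a"
  note surj = group_hom_Mod(2)[OF V]
  interpret Q: group_hom G ?Q ?\<pi> by (rule group_hom_Mod(1)[OF V])
  have normal_image: "?\<pi> ` N \<lhd> ?Q" if "N \<lhd> G" for N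
    by (rule normal.surj_hom_normal_subgroup[OF that Q.group_hom_axioms surj])
  have kernel: "x \<in> V" if "?\<pi> x = \<one>\<^bsub>?Q\<^esub>" "x \<in> carrier G" for x
    using that coset_join1[OF _ that(2) normal_imp_subgroup[OF V]] by simp
  have kernel': "?\<pi> x = \<one>\<^bsub>?Q\<^esub>" if "x \<in> V" for x
    using that coset_join2[OF _ normal_imp_subgroup[OF V] that] subgroup.subset[OF normal_imp_subgroup[OF V]] by auto
  have "generate ?Q (?\<pi> ` S) = carrier ?Q" using Q.generate_img[OF S(2)] S(3) surj by simp
  then have fgQ: "finitely_generated_group ?Q"
    unfolding finitely_generated_group_def using S(1,2) surj Q.H.group_axioms
    by (intro conjI exI[of _ "?\<pi> ` S"]) auto
  have commQ: "x \<otimes>\<^bsub>?Q\<^esub> y = y \<otimes>\<^bsub>?Q\<^esub> x" if xy: "x \<in> ?\<pi> ` B1" "y \<in> ?\<pi> ` B2" for x y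
  proof -
    obtain a b where ab: "a \<in> B1" "b \<in> B2" "x = ?\<pi> a" "y = ?\<pi> b" using xy by blast
    then have abc: "a \<in> carrier G" "b \<in> carrier G" using Bc by auto
    have "commutator G a b \<in> V" using CV ab by (auto simp: C_def)
    then have "?\<pi> (commutator G a b) = \<one>\<^bsub>?Q\<^esub>" by (rule kernel')
    then have e: "commutator ?Q x y = \<one>\<^bsub>?Q\<^esub>" unfolding ab(3,4) using Q.hom_commutator[OF abc] by simp
    have xyc: "x \<in> carrier ?Q" "y \<in> carrier ?Q" using ab abc Q.hom_closed by auto
    have "x \<otimes>\<^bsub>?Q\<^esub> y = commutator ?Q x y \<otimes>\<^bsub>?Q\<^esub> (y \<otimes>\<^bsub>?Q\<^esub> x)"
      using xyc by (simp add: Q.H.word del: mult_FactGroup one_FactGroup)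
    also have "\<dots> = y \<otimes>\<^bsub>?Q\<^esub> x" unfolding e by (rule Q.H.l_one) (rule Q.H.m_closed[OF xyc(2,1)])
    finally show ?thesis .
  qed
  have "?\<pi> ` R \<subseteq> ?\<pi> ` B1 \<inter> ?\<pi> ` B2" using R(2) by blast
  note Q.H.normal_closure_finite_if_commuting[OF fgQ normal_image[OF B(1)] normal_image[OF B(2)] commQ
      Q.virtually_nilpotent_modulo_image[OF surj vn(1)] Q.virtually_nilpotent_modulo_image[OF surj vn(2)]
      normal_image[OF R(1)] this]
  then obtain Y' where Y': "finite Y'" "Y' \<subseteq> ?\<pi> ` R" "?\<pi> ` R = conj_closure ?Q (carrier ?Q) Y'"
    by blast
  obtain Y where Y: "Y \<subseteq> R" "finite Y" "Y' = ?\<pi> ` Y"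
    using finite_subset_image[OF Y'(1,2)] by blast
  have "R \<subseteq> N" if N: "N \<lhd> G" "Y \<subseteq> N" "\<forall>x\<in>B1. \<forall>y\<in>B2. commutator G x y \<in> N" for N
  proof
    fix r assume r: "r \<in> R"
    have Ns: "subgroup N G" "invariant_under G (carrier G) N" using N by (auto simp: normal_iff_invariant)
    have "V \<subseteq> N" unfolding V_def by (rule conj_closure_least[OF Ns]) (use N(3) in \<open>auto simp: C_def\<close>)
    have "?\<pi> ` R \<subseteq> ?\<pi> ` N" unfolding Y'(3)
      using normal_image[OF N(1)] N(2) Y(3) by (intro Q.H.conj_closure_least) (auto simp: Q.H.normal_iff_invariant)
    then obtain x where x: "x \<in> N" "?\<pi> r = ?\<pi> x" using r by auto
    have c: "r \<in> carrier G" "x \<in> carrier G"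
      using r x subgroup.subset[OF normal_imp_subgroup[OF R(1)]] subgroup.subset[OF Ns(1)] by auto
    have "?\<pi> (r \<otimes> inv x) = ?\<pi> x \<otimes>\<^bsub>?Q\<^esub> inv\<^bsub>?Q\<^esub> ?\<pi> x" using c x(2) Q.hom_mult Q.hom_inv by simp
    also have "\<dots> = \<one>\<^bsub>?Q\<^esub>" by (rule Q.H.r_inv) (rule Q.hom_closed[OF c(2)])
    finally have "r \<otimes> inv x \<in> N" using kernel c \<open>V \<subseteq> N\<close> by auto
    then have "r \<otimes> inv x \<otimes> x \<in> N" using x subgroup.m_closed[OF Ns(1)] by blast
    then show "r \<in> N" using c by (simp add: word)
  qed
  then have "\<forall>N. N \<lhd> G \<and> Y \<subseteq> N \<and> (\<forall>x\<in>B1. \<forall>y\<in>B2. commutator G x y \<in> N) \<longrightarrow> R \<subseteq> N"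
    by (intro allI impI) simp
  with Y(1,2) show ?thesis by (intro exI[of _ Y] conjI)
qed

end

section \<open>Subdirect products\<close>

lemma finitely_generated_lift:
  assumes hom: "group_hom G A p" and surj: "p ` carrier G = carrier A" and fg: "finitely_generated_group A"
  shows "\<exists>S. finite S \<and> S \<subseteq> carrier G \<and> (\<forall>J. subgroup J G \<and> S \<subseteq> J \<longrightarrow> p ` J = carrier A)"
proof -
  interpret group_hom G A p by (rule hom)
  obtain S' where S': "finite S'" "S' \<subseteq> p ` carrier G" "generate A S' = carrier A"
    using fg surj by (auto simp: finitely_generated_group_def)
  obtain S where S: "S \<subseteq> carrier G" "finite S" "S' = p ` S"
    using finite_subset_image[OF S'(1,2)] by blast
  have "p ` J = carrier A" if J: "subgroup J G" "S \<subseteq> J" for J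
  proof
    show "p ` J \<subseteq> carrier A" using subgroup.subset[OF J(1)] by auto
    show "carrier A \<subseteq> p ` J"
      using H.generate_subgroup_incl[of S' "p ` J"] S(3) S'(3) J subgroup_img_is_subgroup[OF J(1)] by auto
  qed
  then show ?thesis using S(1,2) by blast
qed

lemma normal_image_of_subgroup:
  assumes hom: "group_hom G A p" and J: "subgroup J G" and surj: "p ` J = carrier A"
    and N: "N \<lhd> G"
  shows "p ` (J \<inter> N) \<lhd> A"
proof -
  interpret group_hom G A p by (rule hom)
  have JN: "subgroup (J \<inter> N) G" by (rule G.subgroups_Inter_pair[OF J normal_imp_subgroup[OF N]])
  have "invariant_under A (carrier A) (p ` (J \<inter> N))"
    unfolding invariant_under_def
  proof (intro ballI)
    fix a x assume "a \<in> carrier A" and x: "x \<in> p ` (J \<inter> N)"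
    then have "a \<in> p ` J" using surj by simp
    with x obtain j y where j: "j \<in> J" "a = p j" and y: "y \<in> J" "y \<in> N" "x = p y"
      by blast
    have c: "j \<in> carrier G" "y \<in> carrier G" using j y subgroup.subset[OF J] by auto
    have "j \<otimes>\<^bsub>G\<^esub> y \<otimes>\<^bsub>G\<^esub> inv\<^bsub>G\<^esub> j \<in> J" using j y J by (simp add: subgroup.m_closed subgroup.m_inv_closed)
    moreover have "j \<otimes>\<^bsub>G\<^esub> y \<otimes>\<^bsub>G\<^esub> inv\<^bsub>G\<^esub> j \<in> N" using N c y by (simp add: G.normal_inv_iff)
    ultimately have "p (j \<otimes>\<^bsub>G\<^esub> y \<otimes>\<^bsub>G\<^esub> inv\<^bsub>G\<^esub> j) \<in> p ` (J \<inter> N)" by blast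
    then show "a \<otimes>\<^bsub>A\<^esub> x \<otimes>\<^bsub>A\<^esub> inv\<^bsub>A\<^esub> a \<in> p ` (J \<inter> N)" using c by (simp add: j(2) y(3))
  qed
  then show ?thesis
    using subgroup_img_is_subgroup[OF JN] by (simp add: H.normal_iff_invariant)
qed

text \<open>The image of \<open>G\<close> in \<open>A \<times> B\<close> is finitely generated: it is a fibre product of finitely generated
groups over a finitely presented group. Let \<open>J\<close> contain lifts of generators of \<open>A\<close> and of
\<open>B\<close>, and elements of \<open>ker q\<close> whose images normally generate \<open>p(ker q)\<close> in \<open>A\<close>.
As \<open>p(J) = A\<close>, the image of \<open>J \<inter> ker q\<close> is normal in \<open>A\<close> and so equals \<open>p(ker q)\<close>.
The quantification over all larger \<open>J\<close> allows the finite sets for several pairs to be united.\<close>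

lemma pair_finitely_generated:
  assumes p: "group_hom G A p" "p ` carrier G = carrier A" "finitely_generated_group A"
    and q: "group_hom G B q" "q ` carrier G = carrier B" "finitely_generated_group B"
    and vn: "virtually_nilpotent_modulo A (p ` kernel G B q)"
  shows "\<exists>S. finite S \<and> S \<subseteq> carrier G \<and>
    (\<forall>J. subgroup J G \<and> S \<subseteq> J \<longrightarrow> (\<forall>g\<in>carrier G. \<exists>j\<in>J. p j = p g \<and> q j = q g))"
proof -
  interpret p: group_hom G A p by (rule p)
  interpret q: group_hom G B q by (rule q)
  let ?K = "kernel G B q"
  obtain S where "finite S \<and> S \<subseteq> carrier G \<and> (\<forall>J. subgroup J G \<and> S \<subseteq> J \<longrightarrow> p ` J = carrier A)"
    using finitely_generated_lift[OF p] by (rule exE)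
  then have S: "finite S" "S \<subseteq> carrier G" "\<And>J. subgroup J G \<Longrightarrow> S \<subseteq> J \<Longrightarrow> p ` J = carrier A"
    by simp_all
  obtain T where "finite T \<and> T \<subseteq> carrier G \<and> (\<forall>J. subgroup J G \<and> T \<subseteq> J \<longrightarrow> q ` J = carrier B)"
    using finitely_generated_lift[OF q] by (rule exE)
  then have T: "finite T" "T \<subseteq> carrier G" "\<And>J. subgroup J G \<Longrightarrow> T \<subseteq> J \<Longrightarrow> q ` J = carrier B"
    by simp_all
  have K: "?K \<lhd> G" by (rule q.normal_kernel)
  have Kc: "?K \<subseteq> carrier G" by (auto simp: kernel_def)
  have pK: "p ` ?K \<lhd> A" by (rule normal.surj_hom_normal_subgroup[OF K p(1,2)])
  obtain S' where S': "finite S'" "S' \<subseteq> carrier A" "carrier A = generate A S'"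
    using p(3) by (auto simp: finitely_generated_group_def)
  obtain H n where "finite_index A H" "lower_central_series (A\<lparr>carrier := H\<rparr>) n \<subseteq> p ` ?K"
    using vn by (auto simp: virtually_nilpotent_modulo_def)
  note p.H.normal_closure_finite_if_virtually_nilpotent_quotient[OF S' this pK]
  then obtain Y' where Y': "finite Y'" "Y' \<subseteq> p ` ?K" "p ` ?K = conj_closure A (carrier A) Y'" by blast
  obtain Y where Y: "Y \<subseteq> ?K" "finite Y" "Y' = p ` Y"
    using finite_subset_image[OF Y'(1,2)] by blast
  have "\<exists>j\<in>J. p j = p g \<and> q j = q g"
    if J: "subgroup J G" "S \<union> T \<union> Y \<subseteq> J" and g: "g \<in> carrier G" for J g
  proof -
    have "p ` (J \<inter> ?K) \<lhd> A" using normal_image_of_subgroup[OF p(1) J(1) _ K] S(3) J by simp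
    then have "p ` ?K \<subseteq> p ` (J \<inter> ?K)"
      unfolding Y'(3) using Y J by (intro p.H.conj_closure_least) (auto simp: p.H.normal_iff_invariant)
    moreover have "q g \<in> q ` J" using T(3)[OF J(1)] J(2) q.hom_closed[OF g] by simp
    then obtain j where j: "j \<in> J" "q j = q g" by (metis imageE)
    have jc: "j \<in> carrier G" using j subgroup.subset[OF J(1)] by auto
    have "g \<otimes>\<^bsub>G\<^esub> inv\<^bsub>G\<^esub> j \<in> ?K" using g jc j(2) by (simp add: kernel_def)
    ultimately obtain k where k: "k \<in> J" "k \<in> ?K" "p (g \<otimes>\<^bsub>G\<^esub> inv\<^bsub>G\<^esub> j) = p k" by blast
    have kc: "k \<in> carrier G" using k(2) Kc by auto
    have "p (k \<otimes>\<^bsub>G\<^esub> j) = p (g \<otimes>\<^bsub>G\<^esub> inv\<^bsub>G\<^esub> j \<otimes>\<^bsub>G\<^esub> j)" using kc jc g k(3) by simp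
    then have "p (k \<otimes>\<^bsub>G\<^esub> j) = p g" using jc g by (simp add: p.G.word)
    moreover have "q (k \<otimes>\<^bsub>G\<^esub> j) = q g" using k(2) kc jc j g by (simp add: kernel_def)
    moreover have "k \<otimes>\<^bsub>G\<^esub> j \<in> J" using k j subgroup.m_closed[OF J(1)] by blast
    ultimately show ?thesis by blast
  qed
  then have "\<forall>J. subgroup J G \<and> S \<union> T \<union> Y \<subseteq> J \<longrightarrow> (\<forall>g\<in>carrier G. \<exists>j\<in>J. p j = p g \<and> q j = q g)"
    by simp
  moreover have "finite (S \<union> T \<union> Y)" "S \<union> T \<union> Y \<subseteq> carrier G" using S(1,2) T(1,2) Y(1,2) Kc by auto
  ultimately show ?thesis by (intro exI[of _ "S \<union> T \<union> Y"] conjI)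
qed

text \<open>Let \<open>J\<close> be generated by finite sets that make it surject onto all three pairs of factors, and by
a finite subset \<open>Y\<close> of \<open>N1 \<inter> N2\<close>. The image of \<open>J \<inter> N1 \<inter> N2\<close> in \<open>A3\<close> is a normal subgroup. It
contains every commutator \<open>[p3 x, p3 y]\<close> with \<open>x \<in> N1\<close> and \<open>y \<in> N2\<close>: replace
\<open>x\<close> by an element of \<open>J\<close> with the same first and third coordinates and \<open>y\<close> by one with
the same second and third coordinates. For a suitable \<open>Y\<close> it is therefore all of \<open>p3(N1 \<inter> N2)\<close>, so \<open>J\<close>
contains \<open>N1 \<inter> N2\<close>, on which \<open>p3\<close> is injective. As \<open>J\<close> also surjects onto the first two factors, \<open>J = G\<close>.\<close>

theorem finitely_generated_if_three_projections:
  assumes p1: "group_hom G A1 p1" "p1 ` carrier G = carrier A1" "finitely_generated_group A1"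
    and p2: "group_hom G A2 p2" "p2 ` carrier G = carrier A2" "finitely_generated_group A2"
    and p3: "group_hom G A3 p3" "p3 ` carrier G = carrier A3" "finitely_generated_group A3"
    and inj: "kernel G A1 p1 \<inter> kernel G A2 p2 \<inter> kernel G A3 p3 \<subseteq> {\<one>\<^bsub>G\<^esub>}"
    and vn12: "virtually_nilpotent_modulo A1 (p1 ` kernel G A2 p2)"
    and vn31: "virtually_nilpotent_modulo A3 (p3 ` kernel G A1 p1)"
    and vn32: "virtually_nilpotent_modulo A3 (p3 ` kernel G A2 p2)"
  shows "finitely_generated_group G"
proof -
  interpret p1: group_hom G A1 p1 by (rule p1)
  interpret p2: group_hom G A2 p2 by (rule p2)
  interpret p3: group_hom G A3 p3 by (rule p3)
  let ?N1 = "kernel G A1 p1" and ?N2 = "kernel G A2 p2"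
  obtain S12 where "finite S12 \<and> S12 \<subseteq> carrier G \<and> (\<forall>J. subgroup J G \<and> S12 \<subseteq> J \<longrightarrow>
      (\<forall>g\<in>carrier G. \<exists>j\<in>J. p1 j = p1 g \<and> p2 j = p2 g))"
    using pair_finitely_generated[OF p1 p2 vn12] by (rule exE)
  then have S12: "finite S12" "S12 \<subseteq> carrier G" "\<And>J g. subgroup J G \<Longrightarrow> S12 \<subseteq> J \<Longrightarrow>
      g \<in> carrier G \<Longrightarrow> \<exists>j\<in>J. p1 j = p1 g \<and> p2 j = p2 g"
    by simp_all
  obtain S31 where "finite S31 \<and> S31 \<subseteq> carrier G \<and> (\<forall>J. subgroup J G \<and> S31 \<subseteq> J \<longrightarrow>
      (\<forall>g\<in>carrier G. \<exists>j\<in>J. p3 j = p3 g \<and> p1 j = p1 g))"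
    using pair_finitely_generated[OF p3 p1 vn31] by (rule exE)
  then have S31: "finite S31" "S31 \<subseteq> carrier G" "\<And>J g. subgroup J G \<Longrightarrow> S31 \<subseteq> J \<Longrightarrow>
      g \<in> carrier G \<Longrightarrow> \<exists>j\<in>J. p3 j = p3 g \<and> p1 j = p1 g"
    by simp_all
  obtain S32 where "finite S32 \<and> S32 \<subseteq> carrier G \<and> (\<forall>J. subgroup J G \<and> S32 \<subseteq> J \<longrightarrow>
      (\<forall>g\<in>carrier G. \<exists>j\<in>J. p3 j = p3 g \<and> p2 j = p2 g))"
    using pair_finitely_generated[OF p3 p2 vn32] by (rule exE)
  then have S32: "finite S32" "S32 \<subseteq> carrier G" "\<And>J g. subgroup J G \<Longrightarrow> S32 \<subseteq> J \<Longrightarrow>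
      g \<in> carrier G \<Longrightarrow> \<exists>j\<in>J. p3 j = p3 g \<and> p2 j = p2 g"
    by simp_all
  have N: "?N1 \<lhd> G" "?N2 \<lhd> G" "?N1 \<inter> ?N2 \<lhd> G"
    using p1.normal_kernel p2.normal_kernel p1.G.normal_subgroup_intersect by auto
  have img: "p3 ` N \<lhd> A3" if "N \<lhd> G" for N
    by (rule normal.surj_hom_normal_subgroup[OF that p3(1,2)])
  have "p3 ` (?N1 \<inter> ?N2) \<subseteq> p3 ` ?N1 \<inter> p3 ` ?N2" by blast
  note p3.H.normal_closure_finite_with_commutators[OF p3(3) img[OF N(1)] img[OF N(2)] vn31 vn32 img[OF N(3)] this]
  then obtain Y' where "finite Y' \<and> Y' \<subseteq> p3 ` (?N1 \<inter> ?N2) \<and>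
      (\<forall>N. N \<lhd> A3 \<and> Y' \<subseteq> N \<and> (\<forall>x\<in>p3 ` ?N1. \<forall>y\<in>p3 ` ?N2. commutator A3 x y \<in> N) \<longrightarrow>
        p3 ` (?N1 \<inter> ?N2) \<subseteq> N)"
    by (rule exE)
  then have Y': "finite Y'" "Y' \<subseteq> p3 ` (?N1 \<inter> ?N2)"
    "\<And>N. N \<lhd> A3 \<Longrightarrow> Y' \<subseteq> N \<Longrightarrow> (\<forall>x\<in>p3 ` ?N1. \<forall>y\<in>p3 ` ?N2. commutator A3 x y \<in> N) \<Longrightarrow>
      p3 ` (?N1 \<inter> ?N2) \<subseteq> N"
    by simp_all
  obtain Y where Y: "Y \<subseteq> ?N1 \<inter> ?N2" "finite Y" "Y' = p3 ` Y"
    using finite_subset_image[OF Y'(1,2)] by blast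
  define S where "S = S12 \<union> S31 \<union> S32 \<union> Y"
  have S: "finite S" "S \<subseteq> carrier G"
    using S12(1,2) S31(1,2) S32(1,2) Y(1,2) by (auto simp: S_def kernel_def)
  define J where "J = generate G S"
  have J: "subgroup J G" unfolding J_def by (rule p1.G.generate_is_subgroup[OF S(2)])
  have SJ: "S \<subseteq> J" unfolding J_def by (auto intro: generate.incl)
  note c = subsetD[OF subgroup.subset[OF J]]
  note J_closed = subgroup.m_closed[OF J] subgroup.m_inv_closed[OF J]
  have "p3 ` J = carrier A3"
  proof
    show "p3 ` J \<subseteq> carrier A3" using c by auto
    show "carrier A3 \<subseteq> p3 ` J"
    proof
      fix a assume "a \<in> carrier A3"
      then obtain g where g: "g \<in> carrier G" "a = p3 g" using p3(2) by blast
      have "S31 \<subseteq> J" using SJ by (simp add: S_def)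
      then obtain j where "j \<in> J" "p3 j = p3 g" using S31(3)[OF J _ g(1)] by blast
      then show "a \<in> p3 ` J" by (simp add: g(2) rev_image_eqI)
    qed
  qed
  then have "p3 ` (J \<inter> (?N1 \<inter> ?N2)) \<lhd> A3" by (rule normal_image_of_subgroup[OF p3(1) J _ N(3)])
  moreover have "Y' \<subseteq> p3 ` (J \<inter> (?N1 \<inter> ?N2))" using Y SJ by (auto simp: S_def)
  \<comment> \<open>the commutator of the two replacements lies in \<open>J\<close>, and in both kernels\<close>
  moreover have "commutator A3 (p3 x) (p3 y) \<in> p3 ` (J \<inter> (?N1 \<inter> ?N2))"
    if xy: "x \<in> ?N1" "y \<in> ?N2" for x y
  proof -
    have xyc: "x \<in> carrier G" "y \<in> carrier G" using xy by (auto simp: kernel_def)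
    obtain u where u: "u \<in> J" "p3 u = p3 x" "p1 u = p1 x" using S31(3)[OF J _ xyc(1)] SJ by (auto simp: S_def)
    obtain v where v: "v \<in> J" "p3 v = p3 y" "p2 v = p2 y" using S32(3)[OF J _ xyc(2)] SJ by (auto simp: S_def)
    note uc = c[OF u(1)] and vc = c[OF v(1)]
    have "commutator G u v \<in> J" using u v J_closed by simp
    moreover have "p1 u = \<one>\<^bsub>A1\<^esub>" "p2 v = \<one>\<^bsub>A2\<^esub>" using u v xy by (auto simp: kernel_def)
    then have "commutator G u v \<in> ?N1 \<inter> ?N2" using uc vc by (simp add: kernel_def)
    ultimately have "p3 (commutator G u v) \<in> p3 ` (J \<inter> (?N1 \<inter> ?N2))" by blast
    then show ?thesis using p3.hom_commutator[OF uc vc] by (simp add: u v)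
  qed
  ultimately have R: "p3 ` (?N1 \<inter> ?N2) \<subseteq> p3 ` (J \<inter> (?N1 \<inter> ?N2))" by (intro Y'(3)) auto
  have "carrier G \<subseteq> J"
  proof
    fix g assume g: "g \<in> carrier G"
    obtain j where j: "j \<in> J" "p1 j = p1 g" "p2 j = p2 g" using S12(3)[OF J _ g] SJ by (auto simp: S_def)
    note jc = c[OF j(1)]
    have "g \<otimes>\<^bsub>G\<^esub> inv\<^bsub>G\<^esub> j \<in> ?N1 \<inter> ?N2" using g jc j by (simp add: kernel_def)
    then obtain k where k: "k \<in> J" "k \<in> ?N1 \<inter> ?N2" "p3 (g \<otimes>\<^bsub>G\<^esub> inv\<^bsub>G\<^esub> j) = p3 k" using R by blast
    note kc = c[OF k(1)]
    let ?z = "g \<otimes>\<^bsub>G\<^esub> inv\<^bsub>G\<^esub> j \<otimes>\<^bsub>G\<^esub> inv\<^bsub>G\<^esub> k"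
    have "p3 ?z = p3 (g \<otimes>\<^bsub>G\<^esub> inv\<^bsub>G\<^esub> j) \<otimes>\<^bsub>A3\<^esub> inv\<^bsub>A3\<^esub> p3 k"
      using g jc kc p3.hom_mult p3.hom_inv by simp
    then have "p3 ?z = \<one>\<^bsub>A3\<^esub>" using kc by (simp only: k(3)) simp
    moreover have "p1 ?z = \<one>\<^bsub>A1\<^esub>" "p2 ?z = \<one>\<^bsub>A2\<^esub>" using g jc kc j k(2) by (simp_all add: kernel_def)
    moreover have "?z \<in> carrier G" using g jc kc by simp
    ultimately have "?z \<in> ?N1 \<inter> ?N2 \<inter> kernel G A3 p3" unfolding kernel_def by blast
    then have "?z = \<one>\<^bsub>G\<^esub>" using inj by blast
    then have "?z \<otimes>\<^bsub>G\<^esub> (k \<otimes>\<^bsub>G\<^esub> j) = k \<otimes>\<^bsub>G\<^esub> j" using kc jc by simp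
    then have "g = k \<otimes>\<^bsub>G\<^esub> j" using g jc kc by (simp add: p1.G.word)
    then show "g \<in> J" using J_closed k j by simp
  qed
  then have "generate G S = carrier G" using subgroup.subset[OF J] by (auto simp: J_def)
  then show ?thesis unfolding finitely_generated_group_def using S p1.G.group_axioms by blast
qed

text \<open>The quotient of a subdirect product \<open>S \<le> A \<times> B\<close> is also the quotient of \<open>A\<close> by
\<open>{x. (x, 1) \<in> S}\<close>, and symmetrically for \<open>B\<close>.\<close>

lemma subdirect2_virtually_nilpotent_modulo:
  assumes A: "group A" and B: "group B" and S: "subdirect2_over_virtually_nilpotent A B S"
  shows "virtually_nilpotent_modulo A {x. (x, \<one>\<^bsub>B\<^esub>) \<in> S}"
    and "virtually_nilpotent_modulo B {y. (\<one>\<^bsub>A\<^esub>, y) \<in> S}"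
proof -
  define G where "G = (A \<times>\<times> B)\<lparr>carrier := S\<rparr>"
  define K where "K = kernel G A fst <#>\<^bsub>G\<^esub> kernel G B snd"
  have sub: "subdirect2 A B S" using S by (simp add: subdirect2_over_virtually_nilpotent_def)
  then have Ssub: "subgroup S (A \<times>\<times> B)" and im: "fst ` S = carrier A" "snd ` S = carrier B"
    by (auto simp: subdirect2_def)
  have G: "group G" unfolding G_def
    using Ssub DirProd_group[OF A B] by (simp add: subgroup.subgroup_is_group)
  have homA: "group_hom G A fst"
    using G A im by (auto simp: group_hom_def group_hom_axioms_def hom_def G_def mult_DirProd')
  have homB: "group_hom G B snd"
    using G B im by (auto simp: group_hom_def group_hom_axioms_def hom_def G_def mult_DirProd')
  interpret A: group_hom G A fst by (rule homA)
  interpret B: group_hom G B snd by (rule homB)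
  have "virtually_nilpotent_group (G Mod K)"
    using S by (simp add: subdirect2_over_virtually_nilpotent_def subdirect2_quotient_def Let_def G_def K_def)
  moreover have "K \<lhd> G"
    unfolding K_def G_def by (rule subdirect2_kernels_normal[OF A B sub])
  ultimately have K: "virtually_nilpotent_modulo G K"
    by (rule A.G.virtually_nilpotent_modulo_if_Mod[rotated])
  have cG: "carrier G = S" by (simp add: G_def)
  have mult: "k \<in> carrier G" "l \<in> carrier G" if "k \<in> kernel G A fst" "l \<in> kernel G B snd" for k l
    using that by (auto simp: kernel_def)
  have "fst ` K \<subseteq> {x. (x, \<one>\<^bsub>B\<^esub>) \<in> S}"
  proof
    fix x assume "x \<in> fst ` K"
    then obtain k l where kl: "k \<in> kernel G A fst" "l \<in> kernel G B snd" "x = fst (k \<otimes>\<^bsub>G\<^esub> l)"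
      by (auto simp: K_def set_mult_def)
    then have "x = fst l" using mult[OF kl(1,2)] by (simp add: kernel_def)
    moreover have "(fst l, \<one>\<^bsub>B\<^esub>) \<in> S" using kl(2) by (cases l) (auto simp: kernel_def cG)
    ultimately show "x \<in> {x. (x, \<one>\<^bsub>B\<^esub>) \<in> S}" by simp
  qed
  moreover have "fst ` carrier G = carrier A" using im by (simp add: cG)
  ultimately show "virtually_nilpotent_modulo A {x. (x, \<one>\<^bsub>B\<^esub>) \<in> S}"
    using virtually_nilpotent_modulo_mono[OF A.virtually_nilpotent_modulo_image[OF _ K]] by simp
  have "snd ` K \<subseteq> {y. (\<one>\<^bsub>A\<^esub>, y) \<in> S}"
  proof
    fix x assume "x \<in> snd ` K"
    then obtain k l where kl: "k \<in> kernel G A fst" "l \<in> kernel G B snd" "x = snd (k \<otimes>\<^bsub>G\<^esub> l)"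
      by (auto simp: K_def set_mult_def)
    then have "x = snd k" using mult[OF kl(1,2)] by (simp add: kernel_def)
    moreover have "(\<one>\<^bsub>A\<^esub>, snd k) \<in> S" using kl(1) by (cases k) (auto simp: kernel_def cG)
    ultimately show "x \<in> {y. (\<one>\<^bsub>A\<^esub>, y) \<in> S}" by simp
  qed
  moreover have "snd ` carrier G = carrier B" using im by (simp add: cG)
  ultimately show "virtually_nilpotent_modulo B {y. (\<one>\<^bsub>A\<^esub>, y) \<in> S}"
    using virtually_nilpotent_modulo_mono[OF B.virtually_nilpotent_modulo_image[OF _ K]] by simp
qed

theorem theorem5p2:
  fixes A1 :: "('a, 'm) monoid_scheme"
    and A2 :: "('b, 'n) monoid_scheme"
    and A3 :: "('c, 'k) monoid_scheme"
    and C :: "('a \<times> 'b \<times> 'c) set"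
  assumes "group A1" "group A2" "group A3"
    and "finitely_generated_group A1"
    and "finitely_generated_group A2"
    and "finitely_generated_group A3"
    and "subdirect3 A1 A2 A3 C"
    and "subdirect2_over_virtually_nilpotent A1 A2 ((\<lambda>(x, y, z). (x, y)) ` C)"
    and "subdirect2_over_virtually_nilpotent A1 A3 ((\<lambda>(x, y, z). (x, z)) ` C)"
    and "subdirect2_over_virtually_nilpotent A2 A3 ((\<lambda>(x, y, z). (y, z)) ` C)"
  shows "finitely_generated_group ((A1 \<times>\<times> A2 \<times>\<times> A3)\<lparr>carrier := C\<rparr>)"
proof -
  let ?G = "(A1 \<times>\<times> A2 \<times>\<times> A3)\<lparr>carrier := C\<rparr>"
  let ?p1 = "\<lambda>(x, y, z). x" and ?p2 = "\<lambda>(x, y, z). y" and ?p3 = "\<lambda>(x, y, z). z"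
  have C: "subgroup C (A1 \<times>\<times> A2 \<times>\<times> A3)"
    and surj: "?p1 ` carrier ?G = carrier A1" "?p2 ` carrier ?G = carrier A2" "?p3 ` carrier ?G = carrier A3"
    using assms(7) by (auto simp: subdirect3_def)
  have G: "group ?G"
    using C DirProd_group[OF assms(1) DirProd_group[OF assms(2,3)]] by (simp add: subgroup.subgroup_is_group)
  have hom: "group_hom ?G A1 ?p1" "group_hom ?G A2 ?p2" "group_hom ?G A3 ?p3"
    using G assms(1-3) subgroup.subset[OF C]
    by (auto simp: group_hom_def group_hom_axioms_def hom_def mult_DirProd')
  have "virtually_nilpotent_modulo A1 (?p1 ` kernel ?G A2 ?p2)"
    by (rule virtually_nilpotent_modulo_mono[OF subdirect2_virtually_nilpotent_modulo(1)[OF assms(1,2,8)]])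
      (force simp: kernel_def)
  note vn12 = this
  have "virtually_nilpotent_modulo A3 (?p3 ` kernel ?G A1 ?p1)"
    by (rule virtually_nilpotent_modulo_mono[OF subdirect2_virtually_nilpotent_modulo(2)[OF assms(1,3,9)]])
      (force simp: kernel_def)
  note vn31 = this
  have "virtually_nilpotent_modulo A3 (?p3 ` kernel ?G A2 ?p2)"
    by (rule virtually_nilpotent_modulo_mono[OF subdirect2_virtually_nilpotent_modulo(2)[OF assms(2,3,10)]])
      (force simp: kernel_def)
  note vn32 = this
  have "kernel ?G A1 ?p1 \<inter> kernel ?G A2 ?p2 \<inter> kernel ?G A3 ?p3 \<subseteq> {\<one>\<^bsub>?G\<^esub>}"
    by (auto simp: kernel_def)
  from finitely_generated_if_three_projections[OF hom(1) surj(1) assms(4) hom(2) surj(2) assms(5)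
      hom(3) surj(3) assms(6) this vn12 vn31 vn32]
  show ?thesis .
qed

end
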